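(* For all $f,g\in\mathbf{BL}(\pi)$ and all $u\in\mathbb{R}$, the following sums do not depend on $t\in\mathbb{R}$, and $$\sum_{n=0}^{\infty}\mathcal{K}^{n}[f](t)^2=\int_{-\infty}^{\infty}f(x)^2\,dx,$$ $$\sum_{n=0}^{\infty}\mathcal{K}^{n}[f](t)\,\mathcal{K}^{n}[g](t)=\int_{-\infty}^{\infty}f(x)g(x)\,dx,$$ $$\sum_{n=0}^{\infty}\mathcal{K}^{n}[f](t)\,\mathcal{K}^{n}_t[g(u-t)]=\int_{-\infty}^{\infty}f(x)g(u-x)\,dx.$$
   Context: $\mathbf{BL}(\pi)$ is the space of continuous $L^2(\mathbb{R})$ functions whose Fourier transform $\widehat f(\omega)=\int_{-\infty}^{\infty} f(t)e^{-i\omega t}\,dt$ is supported within $[-\pi,\pi]$. Let $P^{L}_n(\omega)=\sqrt{2n+1}\,L_n(\omega/\pi)$, where $L_n$ is the Legendre polynomial of degree $n$; thus $\frac{1}{2\pi}\int_{-\pi}^{\pi}P^L_n(\omega)P^L_m(\omega)\,d\omega=\delta(m-n)$, where $\delta(0)=1$ and $\delta(j)=0$ for $j\ne 0$. The chromatic derivatives associated with the Legendre polynomials are the linear differential operators $\mathcal{K}^{n}=(-i)^nP^L_n\!\left(i\,\frac{d}{dt}\right)$, i.e. each $\omega^k$ in $P_n^L(\omega)$ is replaced by $i^k\frac{d^k}{dt^k}$ and the result is multiplied by $(-i)^n$. These operators have real coefficients. The subscript in $\mathcal{K}^n_t$ indicates that differentiation is with respect to the variable $t$. *)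

theory Defs
  imports "HOL-Analysis.Analysis" "HOL-Computational_Algebra.Polynomial"
begin

definition square_integrable :: "(real \<Rightarrow> complex) \<Rightarrow> bool" where
  "square_integrable f \<longleftrightarrow>
     f \<in> borel_measurable lborel \<and> integrable lborel (\<lambda>x. (norm (f x))\<^sup>2)"

text \<open>
  For a square integrable function that is not integrable (such as \<^term>\<open>\<lambda>t::real. sin (pi * t) / (pi * t)\<close>)
  the integral of \<open>f(t) e\<^sup>-\<^sup>i\<^sup>\<omega>\<^sup>t\<close> need not exist absolutely; as usual, its Fourier transform is the limit
  in \<open>L\<^sup>2\<close> of the transforms of its truncations to \<open>[-R, R]\<close>.  It is unique only almost everywhere,
  hence a relation.  The integral below is the nonnegative (extended) one, so that a divergent
  distance cannot be mistaken for zero.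
\<close>
definition has_L2_fourier_transform :: "(real \<Rightarrow> complex) \<Rightarrow> (real \<Rightarrow> complex) \<Rightarrow> bool" where
  "has_L2_fourier_transform f F \<longleftrightarrow>
     square_integrable f \<and> square_integrable F \<and>
     ((\<lambda>R. \<integral>\<^sup>+ \<omega>. ennreal ((norm (F \<omega> -
          (LINT t:{-R..R}|lborel. f t * exp (- \<i> * of_real \<omega> * of_real t))))\<^sup>2) \<partial>lborel)
        \<longlongrightarrow> 0) at_top"

definition BL :: "real \<Rightarrow> (real \<Rightarrow> complex) set" where
  "BL \<sigma> = {f. continuous_on UNIV f \<and> square_integrable f \<and>
     (\<exists>F. has_L2_fourier_transform f F \<and> (AE \<omega> in lborel. \<omega> \<notin> {-\<sigma>..\<sigma>} \<longrightarrow> F \<omega> = 0))}"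

text \<open>Rodrigues' formula.\<close>
definition legendre :: "nat \<Rightarrow> real poly" where
  "legendre n = smult (1 / (2 ^ n * fact n)) ((pderiv ^^ n) ([:-1, 0, 1:] ^ n))"

definition PL :: "nat \<Rightarrow> real poly" where
  "PL n = smult (sqrt (2 * real n + 1)) (pcompose (legendre n) [:0, 1 / pi:])"

definition higher_deriv :: "nat \<Rightarrow> (real \<Rightarrow> complex) \<Rightarrow> real \<Rightarrow> complex" where
  "higher_deriv k = (\<lambda>f t. vector_derivative f (at t)) ^^ k"

definition chromatic_deriv :: "nat \<Rightarrow> (real \<Rightarrow> complex) \<Rightarrow> real \<Rightarrow> complex" where
  "chromatic_deriv n f t =
     (- \<i>) ^ n * (\<Sum>k\<le>degree (PL n). of_real (coeff (PL n) k) * \<i> ^ k * higher_deriv k f t)"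

end

theory Submission
  imports Defs "HOL-Probability.Characteristic_Functions" "HOL-Real_Asymp.Real_Asymp"
begin

text \<open>
  If \<open>f\<close> has the Fourier transform \<open>F\<close>, supported in \<open>[-\<pi>, \<pi>]\<close>, then \<open>K\<^sup>n[f](t)\<close> is \<open>\<i>\<^sup>n\<close> times the
  \<open>n\<close>-th Legendre coefficient of \<open>F(\<omega>) e\<^sup>\<i>\<^sup>\<omega>\<^sup>t\<close>.  Let \<open>h\<close> be \<open>f\<close>, \<open>g\<close> or \<open>g(u - x)\<close>,
  with transform \<open>H\<close>.  By the parity of the Legendre polynomials, the product
  \<open>K\<^sup>n[f](t) K\<^sup>n[h](t)\<close> is then the product of the Legendre coefficients of \<open>F(\<omega>) e\<^sup>\<i>\<^sup>\<omega>\<^sup>t\<close> and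
  \<open>H(-\<omega>) e\<^sup>-\<^sup>\<i>\<^sup>\<omega>\<^sup>t\<close>, so the bilinear Parseval identity sums it to a multiple of \<open>\<integral> F(\<omega>) H(-\<omega>) d\<omega>\<close>,
  in which \<open>t\<close> has cancelled.

  The only Fourier theory needed is the duality \<open>\<integral> f \<psi> = \<integral> F \<phi>\<close>, with \<open>\<psi>\<close> the transform of \<open>\<phi>\<close> (Fubini on the truncations of \<open>f\<close>,
  then a limit).  Modulated Gaussians \<open>\<phi>\<close>, for which \<open>\<psi>\<close> concentrates at \<open>t\<close>, give the inversion formula
  for \<open>f(t)\<close>; the choice \<open>\<phi>(\<omega>) = H(-\<omega>)\<close> gives \<open>\<integral> f h\<close> without Plancherel's theorem.
\<close>

section \<open>Duality for the \<open>L\<^sup>2\<close> Fourier transform\<close>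

lemma square_integrable_mult:
  assumes "square_integrable f" "square_integrable g"
  shows "integrable lborel (\<lambda>x. f x * g x)"
proof (rule Bochner_Integration.integrable_bound)
  show "integrable lborel (\<lambda>x. (norm (f x))\<^sup>2 + (norm (g x))\<^sup>2)"
    using assms by (auto simp: square_integrable_def)
  show "(\<lambda>x. f x * g x) \<in> borel_measurable lborel"
    using assms by (auto simp: square_integrable_def)
  have "a * b \<le> a\<^sup>2 + b\<^sup>2" for a b :: real
    using sum_squares_bound[of a b] zero_le_power2[of a] zero_le_power2[of b] by linarith
  then show "AE x in lborel. norm (f x * g x) \<le> norm ((norm (f x))\<^sup>2 + (norm (g x))\<^sup>2)"
    by (auto simp: norm_mult)
qed

lemma square_integrable_set_integrable:
  assumes "square_integrable f"
  shows "set_integrable lborel {a..b} f"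
proof -
  have "square_integrable (indicator {a..b} :: real \<Rightarrow> complex)"
  proof -
    have "(\<lambda>x. (norm (indicator {a..b} x :: complex))\<^sup>2) = (\<lambda>x. indicator {a..b} x :: real)"
      by (auto simp: indicator_def)
    then show ?thesis by (auto simp: square_integrable_def integrable_indicator_iff emeasure_lborel_Icc_eq)
  qed
  from square_integrable_mult[OF this assms]
  show ?thesis
    unfolding set_integrable_def
    by (rule Bochner_Integration.integrable_cong[THEN iffD1, rotated -1]) (auto simp: indicator_def)
qed

lemma square_integrable_zero_outside_integrable:
  assumes "square_integrable f" "\<And>x. x \<notin> {a..b} \<Longrightarrow> f x = 0"
  shows "integrable lborel f"
proof -
  have "f = (\<lambda>x. indicator {a..b} x *\<^sub>R f x)"
    using assms(2) by (auto simp: indicator_def)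
  then show ?thesis
    using square_integrable_set_integrable[OF assms(1), of a b]
    by (simp add: set_integrable_def)
qed

lemma square_integrable_mult_bounded:
  assumes "square_integrable f" "c \<in> borel_measurable lborel" "\<And>x. norm (c x) \<le> B"
  shows "square_integrable (\<lambda>x. c x * f x)"
proof -
  have "integrable lborel (\<lambda>x. B\<^sup>2 * (norm (f x))\<^sup>2)"
    using assms by (auto simp: square_integrable_def)
  then have "integrable lborel (\<lambda>x. (norm (c x * f x))\<^sup>2)"
  proof (rule Bochner_Integration.integrable_bound)
    show "AE x in lborel. norm ((norm (c x * f x))\<^sup>2) \<le> norm (B\<^sup>2 * (norm (f x))\<^sup>2)"
      using assms(3) by (auto simp: norm_mult power_mult_distrib intro!: mult_right_mono power_mono)
  qed (use assms in \<open>auto simp: square_integrable_def\<close>)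
  then show ?thesis using assms by (auto simp: square_integrable_def)
qed

lemma square_integrable_affine:
  assumes "square_integrable f" "c \<noteq> 0"
  shows "square_integrable (\<lambda>x. f (a + c * x))"
  using assms lborel_integrable_real_affine[of "\<lambda>x. (norm (f x))\<^sup>2" c a]
  by (auto simp: square_integrable_def)

text \<open>Convergence in L^2 implies weak convergence. The weighted inequality a b <= a^2 / (2 k)
  + k b^2 / 2 takes the place of Cauchy-Schwarz. The distance is the extended integral that occurs
  in \<open>has_L2_fourier_transform\<close>, and the integrability of each
  \<open>G n x * \<phi> x\<close> is what can be checked directly for transforms of
  truncations.\<close>

lemma tendsto_integral_mult_square_distance:
  assumes F: "square_integrable F" and \<phi>: "square_integrable \<phi>"
    and G: "\<And>n. G n \<in> borel_measurable lborel" "\<And>n. integrable lborel (\<lambda>x. G n x * \<phi> x)"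
    and lim: "((\<lambda>n. \<integral>\<^sup>+x. ennreal ((norm (F x - G n x))\<^sup>2) \<partial>lborel) \<longlongrightarrow> 0) L"
  shows "((\<lambda>n. LINT x|lborel. G n x * \<phi> x) \<longlongrightarrow> (LINT x|lborel. F x * \<phi> x)) L"
proof (rule tendstoI)
  fix e :: real assume e: "e > 0"
  define N where "N = (LINT x|lborel. (norm (\<phi> x))\<^sup>2)"
  have N: "N \<ge> 0" "integrable lborel (\<lambda>x. (norm (\<phi> x))\<^sup>2)"
    using \<phi> by (auto simp: N_def square_integrable_def)
  \<comment> \<open>The weight of the inequality: once the squared distance is below
    \<open>k * e\<close>, the first term contributes less than e / 2, and the second at most e / 2
    because \<open>k * N \<le> e\<close>. The summand 1 keeps the denominator positive when
    \<open>N\<close> is 0.\<close>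
  define k where "k = e / (N + 1)"
  have k: "k > 0" using e N by (auto simp: k_def)
  have kN: "k * N \<le> e" using e N by (simp add: k_def field_simps)
  have "\<forall>\<^sub>F n in L. (\<integral>\<^sup>+x. ennreal ((norm (F x - G n x))\<^sup>2) \<partial>lborel) < ennreal (k * e)"
    using lim by (rule order_tendstoD) (use k e in auto)
  then show "\<forall>\<^sub>F n in L. dist (LINT x|lborel. G n x * \<phi> x) (LINT x|lborel. F x * \<phi> x) < e"
  proof eventually_elim
    case (elim n)
    let ?D = "\<lambda>x. F x - G n x"
    have meas: "?D \<in> borel_measurable lborel" using F G by (auto simp: square_integrable_def)
    \<comment> \<open>The bound on the extended integral makes it finite, which is what turns it
      into a Bochner integral.\<close>
    have Dint: "integrable lborel (\<lambda>x. (norm (?D x))\<^sup>2)"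
      using elim meas by (intro integrableI_bounded) (auto simp: less_top[symmetric] top_unique)
    then have D: "(LINT x|lborel. (norm (?D x))\<^sup>2) < k * e"
      using elim k e by (subst (asm) nn_integral_eq_integral) (auto simp: ennreal_less_iff)
    have "dist (LINT x|lborel. G n x * \<phi> x) (LINT x|lborel. F x * \<phi> x)
        = norm (LINT x|lborel. ?D x * \<phi> x)"
      using G(2) square_integrable_mult[OF F \<phi>]
      by (simp add: dist_norm norm_minus_commute left_diff_distrib)
    also have "\<dots> \<le> (LINT x|lborel. norm (?D x * \<phi> x))"
      by (rule integral_norm_bound)
    also have "\<dots> \<le> (LINT x|lborel. (1 / (2 * k)) * (norm (?D x))\<^sup>2 + (k / 2) * (norm (\<phi> x))\<^sup>2)"
    proof (rule integral_mono)
      show "integrable lborel (\<lambda>x. norm (?D x * \<phi> x))"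
        using G(2)[of n] square_integrable_mult[OF F \<phi>] by (simp add: left_diff_distrib)
      show "integrable lborel (\<lambda>x. (1 / (2 * k)) * (norm (?D x))\<^sup>2 + (k / 2) * (norm (\<phi> x))\<^sup>2)"
        using Dint N by auto
      have "a * b \<le> (1 / (2 * k)) * a\<^sup>2 + (k / 2) * b\<^sup>2" for a b :: real
        using sum_squares_bound[of a "k * b"] k by (simp add: field_simps power2_eq_square)
      then show "norm (?D x * \<phi> x) \<le> (1 / (2 * k)) * (norm (?D x))\<^sup>2 + (k / 2) * (norm (\<phi> x))\<^sup>2" for x
        by (simp add: norm_mult)
    qed
    also have "\<dots> = (1 / (2 * k)) * (LINT x|lborel. (norm (?D x))\<^sup>2) + (k / 2) * N"
      using Dint N by (simp add: N_def)
    also have "\<dots> < (1 / (2 * k)) * (k * e) + (k / 2) * N"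
      using D k by (intro add_strict_right_mono mult_strict_left_mono) auto
    also have "\<dots> \<le> e"
      using k kN by simp
    finally show ?case .
  qed
qed

text \<open>That \<open>h\<close> is square integrable is a hypothesis: deriving it from
  \<open>\<phi>\<close> would amount to Plancherel's theorem. It makes \<open>f x * h x\<close>
  integrable, and this product dominates the integrals over the truncations.\<close>

lemma has_L2_fourier_transform_duality:
  assumes f: "has_L2_fourier_transform f F"
    and \<phi>: "integrable lborel \<phi>" "square_integrable \<phi>"
    and h: "\<And>x. h x = (LINT \<omega>|lborel. \<phi> \<omega> * exp (- \<i> * of_real \<omega> * of_real x))"
    and hsq: "square_integrable h"
  shows "(LINT x|lborel. f x * h x) = (LINT \<omega>|lborel. F \<omega> * \<phi> \<omega>)"
proof -
  let ?e = "\<lambda>\<omega> t. exp (- \<i> * of_real \<omega> * of_real t) :: complex"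
  define T where "T R t = indicator {-R..R} t *\<^sub>R f t" for R t
  define A where "A R \<omega> = (LINT t|lborel. T R t * ?e \<omega> t)" for R \<omega>
  have fsq: "square_integrable f" and Fsq: "square_integrable F"
    using f by (auto simp: has_L2_fourier_transform_def)
  have [measurable]: "f \<in> borel_measurable borel" "\<phi> \<in> borel_measurable borel" "h \<in> borel_measurable borel"
    using fsq \<phi> hsq by (auto simp: square_integrable_def)
  have T: "integrable lborel (T R)" for R
    using square_integrable_set_integrable[OF fsq] by (simp add: T_def[abs_def] set_integrable_def)
  have [measurable]: "T R \<in> borel_measurable borel" for R
    unfolding T_def by measurable
  have norm_e: "norm (?e \<omega> t) = 1" for \<omega> t
    by (simp add: norm_exp_eq_Re)
  \<comment> \<open>The transform of a truncation is bounded by its L^1 norm, so its product with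
    the integrable \<open>\<phi>\<close> is integrable without any L^2 estimate for
    \<open>A R\<close>.\<close>
  have Abound: "norm (A R \<omega>) \<le> (LINT t|lborel. norm (T R t))" for R \<omega>
    unfolding A_def by (rule order.trans[OF integral_norm_bound]) (simp add: norm_mult norm_e)
  have Ameas[measurable]: "A R \<in> borel_measurable borel" for R
    unfolding A_def[abs_def] by measurable
  have Aint: "integrable lborel (\<lambda>\<omega>. A R \<omega> * \<phi> \<omega>)" for R
  proof (rule Bochner_Integration.integrable_bound)
    show "integrable lborel (\<lambda>\<omega>. (LINT t|lborel. norm (T R t)) * norm (\<phi> \<omega>))"
      using \<phi> by auto
    show "AE \<omega> in lborel. norm (A R \<omega> * \<phi> \<omega>) \<le> norm ((LINT t|lborel. norm (T R t)) * norm (\<phi> \<omega>))"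
      using Abound by (auto simp: norm_mult abs_mult intro!: mult_right_mono order.trans[OF _ abs_ge_self])
  qed auto
  have Fub: "(LINT \<omega>|lborel. A R \<omega> * \<phi> \<omega>) = (LINT t|lborel. T R t * h t)" for R
  proof -
    have int: "integrable (lborel \<Otimes>\<^sub>M lborel) (\<lambda>(\<omega>, t). T R t * ?e \<omega> t * \<phi> \<omega>)"
    proof (rule lborel_pair.Fubini_integrable)
      show "integrable lborel (\<lambda>\<omega>. LINT t|lborel. norm (case (\<omega>, t) of (\<omega>, t) \<Rightarrow> T R t * ?e \<omega> t * \<phi> \<omega>))"
        using \<phi> by (simp add: norm_mult norm_e)
      show "AE \<omega> in lborel. integrable lborel (\<lambda>t. case (\<omega>, t) of (\<omega>, t) \<Rightarrow> T R t * ?e \<omega> t * \<phi> \<omega>)"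
      proof (rule AE_I2, simp)
        fix \<omega>
        have "integrable lborel (\<lambda>t. T R t * ?e \<omega> t)"
          by (rule Bochner_Integration.integrable_bound[OF T[of R]]) (auto simp: norm_mult norm_e)
        then show "integrable lborel (\<lambda>t. T R t * exp (- (\<i> * of_real \<omega> * of_real t)) * \<phi> \<omega>)"
          by simp
      qed
    qed measurable
    have "(LINT \<omega>|lborel. A R \<omega> * \<phi> \<omega>) = (LINT \<omega>|lborel. LINT t|lborel. T R t * ?e \<omega> t * \<phi> \<omega>)"
      by (simp add: A_def)
    also have "\<dots> = (LINT t|lborel. LINT \<omega>|lborel. T R t * ?e \<omega> t * \<phi> \<omega>)"
      using lborel_pair.Fubini_integral[OF int] by simp
    also have "\<dots> = (LINT t|lborel. T R t * h t)"
      unfolding h by (simp add: ac_simps flip: integral_mult_right_zero)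
    finally show ?thesis .
  qed
  have "((\<lambda>R. LINT \<omega>|lborel. A R \<omega> * \<phi> \<omega>) \<longlongrightarrow> (LINT \<omega>|lborel. F \<omega> * \<phi> \<omega>)) at_top"
  proof (rule tendsto_integral_mult_square_distance[OF Fsq \<phi>(2) _ Aint])
    show "((\<lambda>R. \<integral>\<^sup>+ \<omega>. ennreal ((norm (F \<omega> - A R \<omega>))\<^sup>2) \<partial>lborel) \<longlongrightarrow> 0) at_top"
      using f by (simp add: has_L2_fourier_transform_def A_def T_def set_lebesgue_integral_def)
  qed auto
  \<comment> \<open>Restriction to integer radii, since dominated convergence below is used for
    sequences.\<close>
  then have 1: "(\<lambda>n. LINT t|lborel. T (real n) t * h t) \<longlonglongrightarrow> (LINT \<omega>|lborel. F \<omega> * \<phi> \<omega>)"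
    unfolding Fub by (rule filterlim_compose) (rule filterlim_real_sequentially)
  have 2: "(\<lambda>n. LINT t|lborel. T (real n) t * h t) \<longlonglongrightarrow> (LINT t|lborel. f t * h t)"
  proof (rule integral_dominated_convergence)
    show "integrable lborel (\<lambda>t. norm (f t * h t))"
      using square_integrable_mult[OF fsq hsq] by auto
    show "AE t in lborel. (\<lambda>n. T (real n) t * h t) \<longlonglongrightarrow> f t * h t"
    proof (rule AE_I2, rule tendsto_eventually)
      fix t
      obtain m where m: "\<bar>t\<bar> \<le> real m" using real_arch_simple by blast
      show "\<forall>\<^sub>F n in sequentially. T (real n) t * h t = f t * h t"
        using eventually_ge_at_top[of m] by eventually_elim (use m in \<open>auto simp: T_def indicator_def abs_le_iff\<close>)
    qed
    show "AE t in lborel. norm (T (real n) t * h t) \<le> norm (f t * h t)" for n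
      by (auto simp: T_def indicator_def)
  qed auto
  show ?thesis using LIMSEQ_unique[OF 2 1] .
qed

section \<open>Fourier inversion\<close>

lemma bounded_integrable_square_integrable:
  fixes f :: "real \<Rightarrow> complex"
  assumes "integrable lborel f" "\<And>x. norm (f x) \<le> B"
  shows "square_integrable f"
proof -
  have "integrable lborel (\<lambda>x. (norm (f x))\<^sup>2)"
  proof (rule Bochner_Integration.integrable_bound)
    show "integrable lborel (\<lambda>x. B * norm (f x))" using assms by auto
    show "AE x in lborel. norm ((norm (f x))\<^sup>2) \<le> norm (B * norm (f x))"
      using assms(2)
      by (auto simp: power2_eq_square abs_mult intro!: mult_right_mono order.trans[OF _ abs_ge_self])
  qed (use assms in auto)
  then show ?thesis using assms by (auto simp: square_integrable_def)
qed

section \<open>Gaussian kernels as an approximate identity\<close>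

lemma gaussian_eq_normal_density:
  assumes "\<epsilon> > 0"
  shows "exp (- (\<epsilon>\<^sup>2 * \<omega>\<^sup>2) / 2) = sqrt (2 * pi) / \<epsilon> * normal_density 0 (1 / \<epsilon>) \<omega>"
proof -
  have "sqrt (2 * pi * (1 / \<epsilon>)\<^sup>2) = sqrt (2 * pi) / \<epsilon>"
    using assms by (simp add: real_sqrt_mult)
  then show ?thesis using assms by (simp add: normal_density_def field_simps)
qed

text \<open>The substitution \<open>\<omega> = z / \<epsilon>\<close> turns the integral into the
  characteristic function of the standard normal distribution at \<open>s / \<epsilon>\<close>. The
  result is written as 2 pi times a probability density in \<open>s\<close>, so that small
  \<open>\<epsilon>\<close> gives an approximate identity.\<close>

lemma gaussian_fourier_integral:
  assumes "\<epsilon> > 0"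
  shows "(LINT \<omega>|lborel. of_real (exp (- (\<epsilon>\<^sup>2 * \<omega>\<^sup>2) / 2)) * exp (\<i> * of_real \<omega> * of_real s))
         = of_real (2 * pi * normal_density 0 \<epsilon> s)"
proof -
  have "(LINT \<omega>|lborel. of_real (exp (- (\<epsilon>\<^sup>2 * \<omega>\<^sup>2) / 2)) * exp (\<i> * of_real \<omega> * of_real s))
     = (1 / \<epsilon>) *\<^sub>R (LINT z|lborel. of_real (exp (- z\<^sup>2 / 2)) * exp (\<i> * of_real z * of_real (s / \<epsilon>)))"
    using assms
    by (subst lborel_integral_real_affine[of "1 / \<epsilon>" _ 0]) (auto simp: field_simps)
  also have "(LINT z|lborel. of_real (exp (- z\<^sup>2 / 2)) * exp (\<i> * of_real z * of_real (s / \<epsilon>)))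
     = of_real (sqrt (2 * pi)) * (LINT z|lborel. std_normal_density z *\<^sub>R iexp (s / \<epsilon> * z))"
    by (subst integral_mult_right_zero[symmetric], rule Bochner_Integration.integral_cong)
       (auto simp: normal_density_def scaleR_conv_of_real mult_ac)
  also have "(LINT z|lborel. std_normal_density z *\<^sub>R iexp (s / \<epsilon> * z)) = char std_normal_distribution (s / \<epsilon>)"
    unfolding char_def by (subst integral_density) auto
  also have "(1 / \<epsilon>) *\<^sub>R (of_real (sqrt (2 * pi)) * char std_normal_distribution (s / \<epsilon>))
     = of_real (sqrt (2 * pi) / \<epsilon> * exp (- (s / \<epsilon>)\<^sup>2 / 2))"
    by (simp add: char_std_normal_distribution scaleR_conv_of_real)
  also have "sqrt (2 * pi) / \<epsilon> * exp (- (s / \<epsilon>)\<^sup>2 / 2) = 2 * pi * normal_density 0 \<epsilon> s"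
  proof -
    have "sqrt (2 * pi * \<epsilon>\<^sup>2) = sqrt (2 * pi) * \<epsilon>"
      using assms by (simp add: real_sqrt_mult)
    moreover have "2 * pi / (sqrt (2 * pi) * \<epsilon>) = sqrt (2 * pi) / \<epsilon>"
      using real_div_sqrt[of "2 * pi"] by (simp flip: divide_divide_eq_left)
    ultimately have "2 * pi * (1 / sqrt (2 * pi * \<epsilon>\<^sup>2)) = sqrt (2 * pi) / \<epsilon>"
      by simp
    then show ?thesis
      unfolding normal_density_def by (simp only: mult.assoc[symmetric] power_divide) simp
  qed
  finally show ?thesis .
qed

text \<open>Near \<open>t\<close> continuity controls \<open>f x - f t\<close>. Far from
  \<open>t\<close> the function may be unbounded and need not be integrable, so a small tail mass of
  the kernel is not enough: there the kernel is dominated by a vanishing constant times one fixed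
  Gaussian, against which \<open>f\<close> is integrable.\<close>

lemma integral_normal_density_tendsto:
  fixes f :: "real \<Rightarrow> complex"
  assumes f: "square_integrable f" and cont: "isCont f t"
  shows "(\<lambda>n. LINT x|lborel. f x * of_real (normal_density t (1 / real (Suc n)) x)) \<longlonglongrightarrow> f t"
proof -
  define \<sigma> where "\<sigma> n = 1 / real (Suc n)" for n
  have \<sigma>: "\<sigma> n > 0" "\<sigma> n \<le> 1" for n by (auto simp: \<sigma>_def)
  \<comment> \<open>The fixed Gaussian for the tails. Being square integrable, it has an integrable
    product with \<open>f\<close>.\<close>
  define w where "w x = exp (- (x - t)\<^sup>2 / 4)" for x :: real
  have w_nd: "w x = sqrt (4 * pi) * normal_density t (sqrt 2) x" for x
    by (simp add: w_def normal_density_def)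
  have wint: "integrable lborel w"
    unfolding w_nd[abs_def] by (intro integrable_mult_right integrable_normal_density) auto
  have [measurable]: "f \<in> borel_measurable borel" "w \<in> borel_measurable borel"
    using f wint by (auto simp: square_integrable_def)
  have w01: "0 \<le> w x" "w x \<le> 1" for x by (auto simp: w_def)
  have wsq: "square_integrable (\<lambda>x. of_real (w x))"
    by (rule bounded_integrable_square_integrable[where B = 1]) (use wint w01 in auto)
  define H where "H x = norm (f x - f t) * w x" for x
  have fw: "integrable lborel (\<lambda>x. f x * of_real (w x))"
    using square_integrable_mult[OF f wsq] .
  have Hint: "integrable lborel H"
  proof -
    have "integrable lborel (\<lambda>x. norm (f x * of_real (w x) - f t * of_real (w x)))"
      using fw wint by (intro integrable_norm Bochner_Integration.integrable_diff) auto
    also have "(\<lambda>x. norm (f x * of_real (w x) - f t * of_real (w x))) = H"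
      unfolding H_def using w01 by (auto simp: norm_mult simp flip: left_diff_distrib)
    finally show ?thesis .
  qed
  have nd_split: "normal_density t (\<sigma> n) x = 1 / sqrt (2 * pi * (\<sigma> n)\<^sup>2) * exp (- (x - t)\<^sup>2 / (2 * (\<sigma> n)\<^sup>2))" for n x
    by (simp add: normal_density_def)
  \<comment> \<open>The exponent is split into two equal halves. For one half
    \<open>\<sigma> n \<le> 1\<close> gives the exponent of \<open>w\<close>; for the other
    \<open>\<bar>x - t\<bar> \<ge> d\<close> gives the factor that is uniform in x.\<close>
  have le_w: "exp (- (x - t)\<^sup>2 / (2 * (\<sigma> n)\<^sup>2)) \<le> w x * exp (- d\<^sup>2 / (4 * (\<sigma> n)\<^sup>2))"
    if "\<bar>x - t\<bar> \<ge> d" "d \<ge> 0" for n x d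
  proof -
    have "(x - t)\<^sup>2 \<ge> d\<^sup>2" using that by (metis abs_le_square_iff abs_of_nonneg)
    moreover have "(x - t)\<^sup>2 \<ge> (x - t)\<^sup>2 * (\<sigma> n)\<^sup>2"
      using \<sigma>[of n] by (intro mult_left_le) (auto simp: power_le_one)
    ultimately have "(x - t)\<^sup>2 * (\<sigma> n)\<^sup>2 + d\<^sup>2 \<le> 2 * (x - t)\<^sup>2" by linarith
    then have "- (x - t)\<^sup>2 / (2 * (\<sigma> n)\<^sup>2) \<le> - (x - t)\<^sup>2 / 4 + - d\<^sup>2 / (4 * (\<sigma> n)\<^sup>2)"
      using \<sigma>[of n] by (simp add: field_simps)
    then show ?thesis by (simp add: w_def flip: exp_add)
  qed
  define C where "C n d = 1 / sqrt (2 * pi * (\<sigma> n)\<^sup>2) * exp (- d\<^sup>2 / (4 * (\<sigma> n)\<^sup>2))" for n d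
  have nd_le: "normal_density t (\<sigma> n) x \<le> C n d * w x" if "\<bar>x - t\<bar> \<ge> d" "d \<ge> 0" for n x d
    unfolding nd_split C_def using le_w[OF that, of n] \<sigma>[of n] by (auto simp: field_simps)
  have C0: "C n d \<ge> 0" for n d by (simp add: C_def)
  \<comment> \<open>The case d = 0 bounds the kernel on the whole line; it serves the integrability
    of its product with \<open>f\<close>.\<close>
  have nd_le0: "normal_density t (\<sigma> n) x \<le> C n 0 * w x" for n x
    by (rule nd_le) auto
  have ndint: "integrable lborel (normal_density t (\<sigma> n))" for n
    using \<sigma>(1) by (rule integrable_normal_density)
  have fnd: "integrable lborel (\<lambda>x. f x * of_real (normal_density t (\<sigma> n) x))" for n
  proof (rule Bochner_Integration.integrable_bound)
    show "integrable lborel (\<lambda>x. C n 0 * norm (f x * of_real (w x)))" using fw by auto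
    show "AE x in lborel. norm (f x * of_real (normal_density t (\<sigma> n) x)) \<le> norm (C n 0 * norm (f x * of_real (w x)))"
      using nd_le0[of n] C0 w01
      by (auto simp: norm_mult abs_mult mult.left_commute[of _ "norm _"] intro!: mult_left_mono)
  qed auto
  \<comment> \<open>The prefactor grows only linearly in n, while the exponential decays like a
    Gaussian in n.\<close>
  have Clim: "(\<lambda>n. C n d) \<longlonglongrightarrow> 0" if "d > 0" for d
    unfolding C_def \<sigma>_def using that by real_asymp
  show ?thesis
  proof (rule tendstoI)
    fix e :: real assume e: "e > 0"
    obtain d where d: "d > 0" "\<And>x. \<bar>x - t\<bar> < d \<Longrightarrow> norm (f x - f t) < e / 2"
      using cont e unfolding continuous_at_eps_delta dist_norm real_norm_def by (meson half_gt_zero)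
    have "(\<lambda>n. C n d * (LINT x|lborel. H x)) \<longlonglongrightarrow> 0"
      using Clim[OF d(1)] by (rule tendsto_mult_left_zero)
    then have "\<forall>\<^sub>F n in sequentially. C n d * (LINT x|lborel. H x) < e / 2"
      by (rule order_tendstoD) (use e in auto)
    then show "\<forall>\<^sub>F n in sequentially. dist (LINT x|lborel. f x * of_real (normal_density t (1 / real (Suc n)) x)) (f t) < e"
    proof eventually_elim
      case (elim n)
      let ?k = "normal_density t (\<sigma> n)"
      have one: "(LINT x|lborel. of_real (?k x)) = (1 :: complex)"
        using integral_normal_density[OF \<sigma>(1), of t n] by simp
      have "(LINT x|lborel. f x * of_real (?k x)) - f t
          = (LINT x|lborel. f x * of_real (?k x)) - (LINT x|lborel. f t * of_real (?k x))"
        using one by simp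
      also have "\<dots> = (LINT x|lborel. (f x - f t) * of_real (?k x))"
        using fnd ndint by (simp add: left_diff_distrib)
      finally have "norm ((LINT x|lborel. f x * of_real (?k x)) - f t)
          = norm (LINT x|lborel. (f x - f t) * of_real (?k x))" by simp
      also have "\<dots> \<le> (LINT x|lborel. norm ((f x - f t) * of_real (?k x)))"
        by (rule integral_norm_bound)
      also have "\<dots> \<le> (LINT x|lborel. (e / 2) * ?k x + C n d * H x)"
      proof (rule integral_mono)
        show "integrable lborel (\<lambda>x. norm ((f x - f t) * of_real (?k x)))"
          using fnd ndint by (intro integrable_norm) (simp add: left_diff_distrib)
        show "integrable lborel (\<lambda>x. (e / 2) * ?k x + C n d * H x)"
          using ndint Hint by auto
        show "norm ((f x - f t) * of_real (?k x)) \<le> (e / 2) * ?k x + C n d * H x" for x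
        proof (cases "\<bar>x - t\<bar> < d")
          case True
          then have "norm (f x - f t) * ?k x \<le> (e / 2) * ?k x"
            using d(2)[of x] by (intro mult_right_mono) auto
          moreover have "C n d * H x \<ge> 0" using C0 w01 by (simp add: H_def)
          ultimately show ?thesis by (simp add: norm_mult)
        next
          case False
          then have "norm (f x - f t) * ?k x \<le> norm (f x - f t) * (C n d * w x)"
            using d(1) by (intro mult_left_mono nd_le) auto
          moreover have "(e / 2) * ?k x \<ge> 0" using e by simp
          ultimately show ?thesis by (simp add: norm_mult H_def mult_ac)
        qed
      qed
      also have "\<dots> = e / 2 + C n d * (LINT x|lborel. H x)"
        using ndint Hint integral_normal_density[OF \<sigma>(1), of t n] by simp
      also have "\<dots> < e" using elim by simp
      finally show ?case by (simp add: dist_norm \<sigma>_def)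
    qed
  qed
qed

text \<open>Duality is applied to a wide Gaussian modulated by
  \<open>exp (\<i> * of_real \<omega> * of_real t)\<close>, whose transform is 2 pi times a narrow
  density centred at \<open>t\<close>. One side tends to 2 pi \<open>f t\<close> by the approximate
  identity; the other by dominated convergence, since the Gaussian factor increases to 1 and
  \<open>F\<close> is integrable. Continuity at \<open>t\<close> ties the result to the actual value
  there.\<close>

lemma L2_fourier_inversion:
  assumes f: "has_L2_fourier_transform f F" and cont: "isCont f t" and F: "integrable lborel F"
  shows "f t = 1 / (2 * pi) * (LINT \<omega>|lborel. F \<omega> * exp (\<i> * of_real \<omega> * of_real t))"
proof -
  define \<sigma> where "\<sigma> n = 1 / real (Suc n)" for n
  have \<sigma>: "\<sigma> n > 0" for n by (auto simp: \<sigma>_def)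
  define \<phi> where "\<phi> n \<omega> = of_real (exp (- ((\<sigma> n)\<^sup>2 * \<omega>\<^sup>2) / 2)) * exp (\<i> * of_real \<omega> * of_real t)" for n \<omega>
  have fsq: "square_integrable f" using f by (simp add: has_L2_fourier_transform_def)
  have norm_\<phi>: "norm (\<phi> n \<omega>) = exp (- ((\<sigma> n)\<^sup>2 * \<omega>\<^sup>2) / 2)" for n \<omega>
    by (simp add: \<phi>_def norm_mult norm_exp_eq_Re)
  have \<phi>_meas[measurable]: "\<phi> n \<in> borel_measurable borel" for n unfolding \<phi>_def by measurable
  have \<phi>_int: "integrable lborel (\<phi> n)" for n
  proof (rule Bochner_Integration.integrable_bound)
    show "integrable lborel (\<lambda>\<omega>. exp (- ((\<sigma> n)\<^sup>2 * \<omega>\<^sup>2) / 2))"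
      unfolding gaussian_eq_normal_density[OF \<sigma>] using \<sigma>[of n]
      by (intro integrable_mult_right integrable_normal_density) auto
  qed (auto simp: norm_\<phi>)
  have \<phi>_sq: "square_integrable (\<phi> n)" for n
    by (rule bounded_integrable_square_integrable[OF \<phi>_int, where B = 1]) (simp add: norm_\<phi>)
  define h where "h n x = complex_of_real (2 * pi * normal_density t (\<sigma> n) x)" for n x
  have h: "h n x = (LINT \<omega>|lborel. \<phi> n \<omega> * exp (- \<i> * of_real \<omega> * of_real x))" for n x
  proof -
    have "h n x = of_real (2 * pi * normal_density 0 (\<sigma> n) (t - x))"
      by (simp add: h_def normal_density_def power2_commute)
    also have "\<dots> = (LINT \<omega>|lborel. of_real (exp (- ((\<sigma> n)\<^sup>2 * \<omega>\<^sup>2) / 2)) * exp (\<i> * of_real \<omega> * of_real (t - x)))"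
      by (rule gaussian_fourier_integral[OF \<sigma>, symmetric])
    also have "\<dots> = (LINT \<omega>|lborel. \<phi> n \<omega> * exp (- \<i> * of_real \<omega> * of_real x))"
    proof -
      have "exp (\<i> * of_real \<omega> * of_real (t - x)) =
          exp (\<i> * of_real \<omega> * of_real t) * exp (- \<i> * of_real \<omega> * of_real x)" for \<omega>
        by (simp add: algebra_simps flip: exp_add)
      then show ?thesis by (simp only: \<phi>_def mult.assoc)
    qed
    finally show ?thesis .
  qed
  have h_sq: "square_integrable (h n)" for n
  proof (rule bounded_integrable_square_integrable)
    show "integrable lborel (h n)"
      unfolding h_def using \<sigma>[of n] by (intro integrable_of_real integrable_mult_right integrable_normal_density)
    show "norm (h n x) \<le> 2 * pi * (1 / sqrt (2 * pi * (\<sigma> n)\<^sup>2))" for x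
    proof -
      have "normal_density t (\<sigma> n) x \<le> 1 / sqrt (2 * pi * (\<sigma> n)\<^sup>2)"
        by (simp add: normal_density_def divide_right_mono)
      then show ?thesis
        unfolding h_def norm_of_real using mult_left_mono[of _ _ "2 * pi"] by (simp add: abs_mult del: times_divide_eq_right)
    qed
  qed
  have dual: "(LINT x|lborel. f x * h n x) = (LINT \<omega>|lborel. F \<omega> * \<phi> n \<omega>)" for n
    by (rule has_L2_fourier_transform_duality[OF f \<phi>_int \<phi>_sq h h_sq])
  have "(\<lambda>n. 2 * pi * (LINT x|lborel. f x * of_real (normal_density t (\<sigma> n) x))) \<longlonglongrightarrow> of_real (2 * pi) * f t"
    unfolding \<sigma>_def of_real_mult of_real_numeral
    by (intro tendsto_mult_left integral_normal_density_tendsto[OF fsq cont])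
  also have "(\<lambda>n. 2 * pi * (LINT x|lborel. f x * of_real (normal_density t (\<sigma> n) x))) = (\<lambda>n. LINT \<omega>|lborel. F \<omega> * \<phi> n \<omega>)"
    unfolding dual[symmetric] h_def by (simp add: mult_ac flip: integral_mult_right_zero)
  finally have 1: "(\<lambda>n. LINT \<omega>|lborel. F \<omega> * \<phi> n \<omega>) \<longlonglongrightarrow> of_real (2 * pi) * f t" .
  have 2: "(\<lambda>n. LINT \<omega>|lborel. F \<omega> * \<phi> n \<omega>) \<longlonglongrightarrow> (LINT \<omega>|lborel. F \<omega> * exp (\<i> * of_real \<omega> * of_real t))"
  proof (rule integral_dominated_convergence)
    show "integrable lborel (\<lambda>\<omega>. norm (F \<omega>))" using F by auto
    show "AE \<omega> in lborel. norm (F \<omega> * \<phi> n \<omega>) \<le> norm (F \<omega>)" for n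
      by (auto simp: norm_mult norm_\<phi> intro!: mult_left_le)
    show "AE \<omega> in lborel. (\<lambda>n. F \<omega> * \<phi> n \<omega>) \<longlonglongrightarrow> F \<omega> * exp (\<i> * of_real \<omega> * of_real t)"
    proof (rule AE_I2)
      fix \<omega>
      have "\<sigma> \<longlonglongrightarrow> 0" unfolding \<sigma>_def by real_asymp
      then have "(\<lambda>n. F \<omega> * \<phi> n \<omega>) \<longlonglongrightarrow> F \<omega> * (of_real (exp (- (0\<^sup>2 * \<omega>\<^sup>2) / 2)) * exp (\<i> * of_real \<omega> * of_real t))"
        unfolding \<phi>_def by (intro tendsto_intros) auto
      then show "(\<lambda>n. F \<omega> * \<phi> n \<omega>) \<longlonglongrightarrow> F \<omega> * exp (\<i> * of_real \<omega> * of_real t)" by simp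
    qed
  qed (use F in auto)
  show ?thesis using LIMSEQ_unique[OF 1 2] by (simp add: nonzero_eq_divide_eq mult.commute)
qed

section \<open>Legendre polynomials\<close>

lemma set_integrable_poly: "set_integrable lborel {a..b} (poly p :: real \<Rightarrow> real)"
  by (rule borel_integrable_atLeastAtMost') (intro continuous_intros)

lemma set_integral_pderiv:
  fixes p :: "real poly"
  assumes "a \<le> b"
  shows "(LINT x:{a..b}|lborel. poly (pderiv p) x) = poly p b - poly p a"
  unfolding set_lebesgue_integral_def
  by (rule integral_FTC_atLeastAtMost[OF assms])
     (auto intro!: continuous_intros poly_DERIV DERIV_subset[of _ _ _ UNIV]
           simp flip: has_real_derivative_iff_has_vector_derivative)

lemma set_integral_poly_parts:
  fixes p q :: "real poly"
  assumes "a \<le> b" "poly q a = 0" "poly q b = 0"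
  shows "(LINT x:{a..b}|lborel. poly (p * pderiv q) x) = - (LINT x:{a..b}|lborel. poly (pderiv p * q) x)"
  using set_integral_pderiv[OF assms(1), of "p * q"] assms(2,3)
    set_integral_add(2)[OF set_integrable_poly[of a b "p * pderiv q"] set_integrable_poly[of a b "pderiv p * q"]]
  by (simp add: pderiv_mult algebra_simps)

text \<open>Each differentiation costs at most one factor \<open>w\<close>. With w = x^2 - 1 it
  follows that the derivatives of order below n of w^n vanish at -1 and 1.\<close>

lemma power_dvd_higher_pderiv:
  fixes w :: "real poly"
  assumes "k \<le> n"
  shows "w ^ (n - k) dvd (pderiv ^^ k) (w ^ n)"
  using assms
proof (induction k)
  case (Suc k)
  then obtain r where r: "(pderiv ^^ k) (w ^ n) = w ^ (n - k) * r"
    by (auto elim: dvdE)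
  obtain m where m: "n - k = Suc m" using Suc.prems by (metis Suc_diff_Suc Suc_le_lessD)
  then have "n - Suc k = m" by simp
  moreover have "(pderiv ^^ Suc k) (w ^ n) = w ^ m * (w * pderiv r + r * smult (of_nat (Suc m)) (pderiv w))"
    by (simp only: funpow.simps o_apply r m pderiv_mult pderiv_power_Suc) (simp add: algebra_simps)
  ultimately show ?case by simp
qed simp

text \<open>Covers two uses at once: the result is zero when the degree is below \<open>n\<close>,
  and n! times the leading coefficient when the degree equals \<open>n\<close>.\<close>

lemma higher_pderiv_degree_le:
  fixes p :: "real poly"
  assumes "degree p \<le> n"
  shows "(pderiv ^^ n) p = [:fact n * coeff p n:]"
  using assms
proof (induction n arbitrary: p)
  case 0
  then show ?case by (auto elim: degree_eq_zeroE)
next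
  case (Suc n)
  then have "degree (pderiv p) \<le> n" by (simp add: degree_pderiv)
  from Suc.IH[OF this] show ?case
    by (simp add: coeff_pderiv funpow_Suc_right algebra_simps del: funpow.simps)
qed

lemma degree_rodrigues: "degree ([:-1, 0, 1:] ^ n :: real poly) = 2 * n"
  by (simp add: degree_power_eq)

lemma lead_coeff_rodrigues: "coeff ([:-1, 0, 1:] ^ n :: real poly) (2 * n) = 1"
  using lead_coeff_power[of "[:-1, 0, 1:] :: real poly" n] by (simp add: degree_rodrigues)

text \<open>Repeated integration by parts. No boundary terms appear, because every derivative of
  order below \<open>n\<close> still contains the factor x^2 - 1.\<close>

lemma set_integral_rodrigues_parts:
  fixes p :: "real poly"
  assumes "k \<le> n"
  shows "(LINT x:{-1..1}|lborel. poly (p * (pderiv ^^ k) ([:-1, 0, 1:] ^ n)) x)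
       = (-1) ^ k * (LINT x:{-1..1}|lborel. poly ((pderiv ^^ k) p * [:-1, 0, 1:] ^ n) x)"
  using assms
proof (induction k arbitrary: p)
  case (Suc k)
  let ?q = "(pderiv ^^ k) ([:-1, 0, 1:] ^ n) :: real poly"
  have "[:-1, 0, 1:] dvd ?q"
    using power_dvd_higher_pderiv[of k n "[:-1, 0, 1:]"] Suc.prems
    by (metis Suc_diff_Suc Suc_le_lessD dvd_trans dvd_triv_left less_or_eq_imp_le power_Suc)
  then have "poly ?q 1 = 0" "poly ?q (-1) = 0" by (auto elim!: dvdE)
  then show ?case
    using Suc set_integral_poly_parts[of "-1" 1 ?q p] by (simp add: funpow_Suc_right del: funpow.simps) (simp add: funpow_swap1)
qed simp

text \<open>The left side is the squared norm of the Legendre polynomial after all derivatives have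
  been moved to one factor. Writing J(n) for the integral, the induction rests on (2n + 3) J(n+1) +
  (2n + 2) J(n) = 0, obtained by integrating the derivative of x (x^2 - 1)^(n+1), a polynomial that
  vanishes at both ends.\<close>

lemma set_integral_rodrigues:
  "(LINT x:{-1..1}|lborel. poly ([:-1, 0, 1:] ^ n) x) * (-1) ^ n * fact (2 * n) / (2 ^ n * fact n)\<^sup>2
     = 2 / (2 * real n + 1)"
proof (induction n)
  case 0
  show ?case by (simp add: set_lebesgue_integral_def content_real)
next
  case (Suc n)
  let ?w = "[:-1, 0, 1:] :: real poly"
  define J where "J n = (LINT x:{-1..1}|lborel. poly (?w ^ n) x)" for n
  \<comment> \<open>The product rule produces x^2 (x^2 - 1)^n; writing x^2 = (x^2 - 1) + 1 brings it
    back to the two powers of interest.\<close>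
  have "pderiv ([:0, 1:] * ?w ^ Suc n) = smult (2 * real n + 3) (?w ^ Suc n) + smult (2 * real n + 2) (?w ^ n)"
  proof (rule poly_ext)
    fix x
    have "poly (pderiv ([:0, 1:] * ?w ^ Suc n)) x
        = (x * x - 1) ^ Suc n + x * ((real n + 1) * (x * x - 1) ^ n * (2 * x))"
      by (simp only: pderiv_mult pderiv_power_Suc) (simp add: pderiv_pCons algebra_simps)
    also have "\<dots> = (2 * real n + 3) * (x * x - 1) ^ Suc n + (2 * real n + 2) * (x * x - 1) ^ n"
      by (simp add: algebra_simps)
    finally show "poly (pderiv ([:0, 1:] * ?w ^ Suc n)) x
        = poly (smult (2 * real n + 3) (?w ^ Suc n) + smult (2 * real n + 2) (?w ^ n)) x"
      by (simp only: poly_add poly_smult poly_power) simp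
  qed
  then have "(LINT x:{-1..1}|lborel. poly (smult (2 * real n + 3) (?w ^ Suc n) + smult (2 * real n + 2) (?w ^ n)) x) = 0"
    using set_integral_pderiv[of "-1" 1 "[:0, 1:] * ?w ^ Suc n"] by simp
  moreover have "(LINT x:{-1..1}|lborel. poly (smult (2 * real n + 3) (?w ^ Suc n) + smult (2 * real n + 2) (?w ^ n)) x)
      = (2 * real n + 3) * J (Suc n) + (2 * real n + 2) * J n"
    unfolding J_def poly_add poly_smult
    by (subst set_integral_add(2))
       (auto intro!: set_integrable_mult_right set_integrable_poly simp del: power_Suc poly_power)
  ultimately have "J (Suc n) = - (2 * real n + 2) / (2 * real n + 3) * J n"
    by (simp add: field_simps add_eq_0_iff)
  then have J: "J (Suc n) = - (2 * (real n + 1)) / (2 * real n + 3) * J n"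
    by simp
  have "J (Suc n) * (-1) ^ Suc n * fact (2 * Suc n) / (2 ^ Suc n * fact (Suc n))\<^sup>2
      = (- (2 * (real n + 1)) / (2 * real n + 3) * J n) * (- ((-1) ^ n))
          * (2 * (real n + 1) * (2 * real n + 1) * fact (2 * n)) / (2 * (real n + 1) * (2 ^ n * fact n))\<^sup>2"
    unfolding J by (simp add: algebra_simps)
  also have "\<dots> = (J n * (-1) ^ n * fact (2 * n) / (2 ^ n * fact n)\<^sup>2) * ((2 * real n + 1) / (2 * real n + 3))"
  proof -
    \<comment> \<open>The cancellation is done with letters for the factorials and powers, so that
      they are not expanded.\<close>
    have "(- (2 * a) / c * j) * (- s) * (2 * a * b * F) / (2 * a * K)\<^sup>2 = (j * s * F / K\<^sup>2) * (b / c)"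
      if "a \<noteq> 0" "K \<noteq> 0" "c \<noteq> 0" for a b c j s F K :: real
      using that by (simp add: field_simps power2_eq_square)
    then show ?thesis by this auto
  qed
  also have "\<dots> = 2 / (2 * real (Suc n) + 1)"
  proof -
    have "2 / a * (a / b) = 2 / b" if "a \<noteq> 0" for a b :: real
      using that by simp
    then have "2 / (2 * real n + 1) * ((2 * real n + 1) / (2 * real n + 3)) = 2 / (2 * real n + 3)"
      by this linarith
    moreover have "2 * real (Suc n) + 1 = 2 * real n + 3" by simp
    ultimately show ?thesis
      unfolding Suc.IH[folded J_def] by (simp only:)
  qed
  finally show ?case unfolding J_def .
qed

text \<open>The polynomial (x^2 - 1)^n is even, and each of the n differentiations changes the
  parity once.\<close>

lemma poly_legendre_minus: "poly (legendre n) (- x) = (-1) ^ n * poly (legendre n) x"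
proof -
  have "poly ((pderiv ^^ k) p) (- x) = (-1) ^ k * poly ((pderiv ^^ k) (pcompose p [:0, -1:])) x" for k and p :: "real poly"
  proof (induction k arbitrary: p)
    case (Suc k)
    have "pcompose (pderiv p) [:0, -1:] = - pderiv (pcompose p [:0, -1:])"
      by (simp add: pderiv_pcompose pderiv_pCons)
    moreover have "(pderiv ^^ k) (- q) = - (pderiv ^^ k) q" for q :: "real poly"
      using higher_pderiv_smult[of k "-1" q] by simp
    ultimately show ?case using Suc.IH[of "pderiv p"]
      by (simp add: funpow_Suc_right del: funpow.simps)
  qed (simp add: poly_pcompose)
  moreover have "pcompose ([:-1, 0, 1:] ^ n) [:0, -1:] = ([:-1, 0, 1:] ^ n :: real poly)"
    by (rule poly_ext) (simp add: poly_pcompose)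
  ultimately show ?thesis by (simp add: legendre_def)
qed

section \<open>Orthogonality, scaling to [-pi, pi] and linear span\<close>

lemma degree_legendre: "degree (legendre n) = n"
  by (simp add: legendre_def degree_higher_pderiv degree_rodrigues)

text \<open>Rodrigues' formula for the second factor allows its \<open>m\<close> derivatives to be
  moved onto \<open>legendre n\<close>. For n < m this gives zero by degree, for n > m the roles are
  exchanged, and for n = m a constant times the integral of (x^2 - 1)^n remains.\<close>

lemma legendre_orthogonal:
  "(LINT x:{-1..1}|lborel. poly (legendre n) x * poly (legendre m) x) = (if n = m then 2 / (2 * real n + 1) else 0)"
proof -
  have red: "(LINT x:{-1..1}|lborel. poly (legendre n) x * poly (legendre m) x)
      = (-1) ^ m / (2 ^ m * fact m) * (LINT x:{-1..1}|lborel. poly ((pderiv ^^ m) (legendre n) * [:-1, 0, 1:] ^ m) x)" for n m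
  proof -
    have "poly (legendre n) x * poly (legendre m) x
        = 1 / (2 ^ m * fact m) * poly (legendre n * (pderiv ^^ m) ([:-1, 0, 1:] ^ m)) x" for x
      by (subst legendre_def[of m]) simp
    then show ?thesis
      by (simp only: set_integral_mult_right set_integral_rodrigues_parts[OF order_refl]) simp
  qed
  have zero: "(LINT x:{-1..1}|lborel. poly (legendre n) x * poly (legendre m) x) = 0" if "n < m" for n m
  proof -
    have "(pderiv ^^ m) (legendre n) = 0"
      using that by (subst higher_pderiv_degree_le) (auto simp: degree_legendre coeff_eq_0)
    then show ?thesis unfolding red by (simp add: set_lebesgue_integral_def)
  qed
  show ?thesis
  proof (cases n m rule: linorder_cases)
    case less
    then show ?thesis using zero by simp
  next
    case greater
    then show ?thesis using zero[of m n] by (simp add: mult.commute)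
  next
    case equal
    have "(pderiv ^^ n) (legendre n) = smult (1 / (2 ^ n * fact n)) ((pderiv ^^ (2 * n)) ([:-1, 0, 1:] ^ n))"
      by (simp add: legendre_def mult_2 funpow_add higher_pderiv_smult)
    also have "\<dots> = [:fact (2 * n) / (2 ^ n * fact n):]"
      by (subst higher_pderiv_degree_le) (auto simp: degree_rodrigues lead_coeff_rodrigues)
    finally have D: "(pderiv ^^ n) (legendre n) = [:fact (2 * n) / (2 ^ n * fact n):]" .
    have "(LINT x:{-1..1}|lborel. poly (legendre n) x * poly (legendre n) x)
        = (-1) ^ n / (2 ^ n * fact n) * ((fact (2 * n) / (2 ^ n * fact n)) * (LINT x:{-1..1}|lborel. poly ([:-1, 0, 1:] ^ n) x))"
    proof -
      have "(LINT x:S|lborel. poly ([:c:] * q) x) = c * (LINT x:S|lborel. poly q x)" for c S and q :: "real poly"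
        unfolding set_integral_mult_right[symmetric] by simp
      then show ?thesis unfolding red by (simp only: D)
    qed
    also have "\<dots> = 2 / (2 * real n + 1)"
      using set_integral_rodrigues[of n] by (simp add: field_simps power2_eq_square)
    finally show ?thesis using equal by simp
  qed
qed

text \<open>The substitution \<open>\<omega> = pi * x\<close> reduces this to the Legendre
  polynomials. The value is 2 pi rather than 1 because the integral is taken without the weight 1 /
  (2 pi).\<close>

lemma PL_orthonormal:
  "(LINT \<omega>:{-pi..pi}|lborel. poly (PL n) \<omega> * poly (PL m) \<omega>) = (if n = m then 2 * pi else 0)"
proof -
  have "(LINT \<omega>:{-pi..pi}|lborel. poly (PL n) \<omega> * poly (PL m) \<omega>)
      = pi * (LINT x|lborel. indicator {-pi..pi} (pi * x) * (poly (PL n) (pi * x) * poly (PL m) (pi * x)))"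
    unfolding set_lebesgue_integral_def
    by (subst lborel_integral_real_affine[of pi _ 0]) auto
  also have "(\<lambda>x. indicator {-pi..pi} (pi * x) * (poly (PL n) (pi * x) * poly (PL m) (pi * x)))
      = (\<lambda>x. sqrt (2 * real n + 1) * sqrt (2 * real m + 1) * (indicator {-1..1} x * (poly (legendre n) x * poly (legendre m) x)))"
  proof
    fix x
    have "pi * x \<in> {-pi..pi} \<longleftrightarrow> x \<in> {-1..1}"
      using mult_le_cancel_left_pos[of pi "-1" x] mult_le_cancel_left_pos[of pi x 1] by auto
    then have "indicator {-pi..pi} (pi * x) = (indicator {-1..1} x :: real)"
      by (simp only: indicator_def)
    then show "indicator {-pi..pi} (pi * x) * (poly (PL n) (pi * x) * poly (PL m) (pi * x)) =
        sqrt (2 * real n + 1) * sqrt (2 * real m + 1) * (indicator {-1..1} x * (poly (legendre n) x * poly (legendre m) x))"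
      by (simp add: PL_def poly_pcompose)
  qed
  also have "(LINT x|lborel. sqrt (2 * real n + 1) * sqrt (2 * real m + 1) * (indicator {-1..1} x * (poly (legendre n) x * poly (legendre m) x)))
      = sqrt (2 * real n + 1) * sqrt (2 * real m + 1) * (if n = m then 2 / (2 * real n + 1) else 0)"
    using legendre_orthogonal[of n m] by (simp add: set_lebesgue_integral_def)
  finally have "(LINT \<omega>:{-pi..pi}|lborel. poly (PL n) \<omega> * poly (PL m) \<omega>)
      = pi * (sqrt (2 * real n + 1) * sqrt (2 * real m + 1) * (if n = m then 2 / (2 * real n + 1) else 0))" .
  moreover have "sqrt (2 * real n + 1) * sqrt (2 * real n + 1) * (2 / (2 * real n + 1)) = 2"
  proof -
    have "sqrt a * sqrt a * (2 / a) = 2" if "a > 0" for a :: real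
      using that by simp
    then show ?thesis by this linarith
  qed
  ultimately show ?thesis
    by (cases "n = m") (simp_all only: refl if_True if_False mult_zero_right mult.commute[of pi])
qed

lemma degree_PL: "degree (PL n) = n"
  by (simp add: PL_def degree_pcompose degree_legendre)

lemma poly_PL_minus: "poly (PL n) (- x) = (-1) ^ n * poly (PL n) x"
  by (simp add: PL_def poly_pcompose poly_legendre_minus)

text \<open>The family has exactly one member of each degree, so the top coefficient can be removed
  by a multiple of \<open>PL N\<close> and the rest treated by induction.\<close>

lemma poly_in_span_PL:
  assumes "degree p < N"
  shows "\<exists>a. p = (\<Sum>n<N. smult (a n) (PL n))"
  using assms
proof (induction N arbitrary: p)
  case (Suc N)
  define c where "c = coeff p N / coeff (PL N) N"
  \<comment> \<open>For N = 0 the degree alone would not exclude the zero polynomial, so the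
    constant is computed.\<close>
  have nz: "coeff (PL N) N \<noteq> 0"
  proof (cases "N = 0")
    case False
    then show ?thesis using degree_PL[of N] by (metis degree_0 leading_coeff_0_iff)
  qed (simp add: PL_def legendre_def)
  let ?q = "p - smult c (PL N)"
  have "degree ?q \<le> N" using Suc.prems degree_PL[of N] by (intro degree_diff_le) auto
  moreover have "coeff ?q N = 0" using nz by (simp add: c_def)
  ultimately consider "?q = 0" | "degree ?q < N"
    by (metis le_neq_implies_less leading_coeff_0_iff)
  then obtain a where a: "?q = (\<Sum>n<N. smult (a n) (PL n))"
  proof cases
    case 1
    then show ?thesis using that[of "\<lambda>_. 0"] by simp
  qed (use Suc.IH that in blast)
  then have "p = (\<Sum>n<N. smult (a n) (PL n)) + smult c (PL N)"
    by (simp add: algebra_simps)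
  then show ?case by (intro exI[of _ "a(N := c)"]) simp
qed simp

section \<open>Completeness and Parseval\<close>

lemma borel_measurable_restrict_lborel:
  "f \<in> borel_measurable lborel \<Longrightarrow> f \<in> borel_measurable (restrict_space lborel S)"
  by (rule measurable_restrict_space1)

lemma borel_measurable_poly [measurable]: "(poly p :: real \<Rightarrow> real) \<in> borel_measurable borel"
  by (intro borel_measurable_continuous_onI continuous_intros)

lemma integrable_mult_of_squares:
  fixes f g :: "'a \<Rightarrow> real"
  assumes "f \<in> borel_measurable M" "g \<in> borel_measurable M"
    and "integrable M (\<lambda>x. (f x)\<^sup>2)" "integrable M (\<lambda>x. (g x)\<^sup>2)"
  shows "integrable M (\<lambda>x. f x * g x)"
proof (rule Bochner_Integration.integrable_bound)
  show "integrable M (\<lambda>x. (f x)\<^sup>2 + (g x)\<^sup>2)" using assms by auto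
  have "\<bar>a * b\<bar> \<le> a\<^sup>2 + b\<^sup>2" for a b :: real
    using sum_squares_bound[of "\<bar>a\<bar>" "\<bar>b\<bar>"] zero_le_power2[of a] zero_le_power2[of b]
    unfolding abs_mult power2_abs by linarith
  then show "AE x in M. norm (f x * g x) \<le> norm ((f x)\<^sup>2 + (g x)\<^sup>2)" by auto
qed (use assms in auto)

text \<open>A substitute for the triangle inequality that works with squared distances; it follows
  from ((a - b) - (b - c))^2 >= 0. The factors 2 explain the tolerances e / 4 in the approximations
  below.\<close>

lemma square_distance_triangle:
  fixes f g h :: "'a \<Rightarrow> real"
  assumes "f \<in> borel_measurable M" "h \<in> borel_measurable M"
    and fg: "integrable M (\<lambda>x. (f x - g x)\<^sup>2)" and gh: "integrable M (\<lambda>x. (g x - h x)\<^sup>2)"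
  shows "integrable M (\<lambda>x. (f x - h x)\<^sup>2)"
    and "(LINT x|M. (f x - h x)\<^sup>2) \<le> 2 * (LINT x|M. (f x - g x)\<^sup>2) + 2 * (LINT x|M. (g x - h x)\<^sup>2)"
proof -
  have le: "(a - c)\<^sup>2 \<le> 2 * (a - b)\<^sup>2 + 2 * (b - c)\<^sup>2" for a b c :: real
    using zero_le_power2[of "(a - b) - (b - c)"] by (simp add: power2_eq_square algebra_simps)
  have int: "integrable M (\<lambda>x. 2 * (f x - g x)\<^sup>2 + 2 * (g x - h x)\<^sup>2)"
    using fg gh by auto
  show *: "integrable M (\<lambda>x. (f x - h x)\<^sup>2)"
    by (rule Bochner_Integration.integrable_bound[OF int])
       (use assms le in \<open>auto intro!: AE_I2 order.trans[OF _ abs_ge_self]\<close>)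
  have "(LINT x|M. (f x - h x)\<^sup>2) \<le> (LINT x|M. 2 * (f x - g x)\<^sup>2 + 2 * (g x - h x)\<^sup>2)"
    using * int le by (rule integral_mono)
  also have "\<dots> = 2 * (LINT x|M. (f x - g x)\<^sup>2) + 2 * (LINT x|M. (g x - h x)\<^sup>2)"
    using fg gh by simp
  finally show "(LINT x|M. (f x - h x)\<^sup>2) \<le> 2 * (LINT x|M. (f x - g x)\<^sup>2) + 2 * (LINT x|M. (g x - h x)\<^sup>2)" .
qed

lemma finite_measure_restrict_lborel_Icc: "finite_measure (restrict_space lborel {a..b :: real})"
  by (intro finite_measureI) (simp add: emeasure_restrict_space space_restrict_space emeasure_lborel_Icc_eq)

lemma continuous_approx_polynomial_L2:
  fixes k :: "real \<Rightarrow> real"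
  assumes k: "continuous_on UNIV k" and e: "e > 0"
  shows "\<exists>p. integrable (restrict_space lborel {a..b}) (\<lambda>x. (k x - poly p x)\<^sup>2)
    \<and> (LINT x|restrict_space lborel {a..b}. (k x - poly p x)\<^sup>2) < e"
proof -
  let ?M = "restrict_space lborel {a..b}"
  interpret finite_measure ?M by (rule finite_measure_restrict_lborel_Icc)
  define m where "m = measure ?M (space ?M)"
  have m: "m \<ge> 0" by (simp add: m_def)
  \<comment> \<open>A uniform error \<open>d\<close> has squared L^2 norm at most d^2 m = e m / (m +
    1) < e, also when the interval has measure m = 0.\<close>
  define d where "d = sqrt (e / (m + 1))"
  have d: "d > 0" using e m by (simp add: d_def)
  obtain q where q: "real_polynomial_function q" "\<And>x. x \<in> {a..b} \<Longrightarrow> \<bar>k x - q x\<bar> < d"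
    using Stone_Weierstrass_real_polynomial_function[of "{a..b}" k d] d continuous_on_subset[OF k]
    by (metis compact_Icc subset_UNIV)
  obtain c n where c: "q = (\<lambda>x. \<Sum>i\<le>n. c i * x ^ i)"
    using q(1) unfolding real_polynomial_function_iff_sum by blast
  define p where "p = (\<Sum>i\<le>n. monom (c i) i)"
  have p: "poly p x = q x" for x by (simp add: p_def c poly_sum poly_monom)
  have [measurable]: "k \<in> borel_measurable borel" using k by (rule borel_measurable_continuous_onI)
  have meas: "(\<lambda>x. (k x - poly p x)\<^sup>2) \<in> borel_measurable ?M"
    by (rule borel_measurable_restrict_lborel) measurable
  have le: "(k x - poly p x)\<^sup>2 \<le> d\<^sup>2" if "x \<in> space ?M" for x
    using that q(2)[of x] d by (simp add: space_restrict_space p abs_le_square_iff[symmetric])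
  have int: "integrable ?M (\<lambda>x. (k x - poly p x)\<^sup>2)"
    by (rule integrable_const_bound[where B = "d\<^sup>2"]) (use le meas in \<open>auto intro!: AE_I2\<close>)
  have "(LINT x|?M. (k x - poly p x)\<^sup>2) \<le> (LINT x|?M. d\<^sup>2)"
    using int le by (intro integral_mono) auto
  also have "\<dots> = e * (m / (m + 1))"
    using e m by (simp add: m_def d_def field_simps)
  also have "\<dots> < e * 1" using e m by (intro mult_strict_left_mono) (auto simp: field_simps)
  finally show ?thesis using int by auto
qed

text \<open>A measurable function is almost everywhere a limit of continuous ones, as provided by
  \<open>measurable_on\<close>. Boundedness upgrades this to L^2 convergence, and the continuous
  case finishes the approximation.\<close>

lemma bounded_approx_polynomial_L2:
  fixes f :: "real \<Rightarrow> real"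
  assumes f: "f \<in> borel_measurable borel" and B: "\<And>x. \<bar>f x\<bar> \<le> B" and e: "e > 0"
  shows "\<exists>p. integrable (restrict_space lborel {a..b}) (\<lambda>x. (f x - poly p x)\<^sup>2)
    \<and> (LINT x|restrict_space lborel {a..b}. (f x - poly p x)\<^sup>2) < e"
proof -
  let ?M = "restrict_space lborel {a..b}"
  interpret finite_measure ?M by (rule finite_measure_restrict_lborel_Icc)
  note f[measurable]
  have "f \<in> borel_measurable (lebesgue_on {a..b})"
    using f by (intro measurable_restrict_space1 measurable_completion) simp
  then have "f measurable_on {a..b}"
    by (subst measurable_on_iff_borel_measurable) auto
  then obtain N g where N: "negligible N" and g: "\<And>n. continuous_on UNIV (g n)"
    and lim: "\<And>x. x \<notin> N \<Longrightarrow> (\<lambda>n. g n x) \<longlonglongrightarrow> (if x \<in> {a..b} then f x else 0)"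
    unfolding measurable_on_def by blast
  \<comment> \<open>Clamping to [-B, B] preserves continuity and the limit, as \<open>f\<close>
    takes values in this interval, and supplies the constant bound for dominated
    convergence.\<close>
  define k where "k n x = max (- B) (min B (g n x))" for n x
  have k: "continuous_on UNIV (k n)" for n
    unfolding k_def by (intro continuous_intros g)
  have [measurable]: "k n \<in> borel_measurable borel" for n
    using k by (rule borel_measurable_continuous_onI)
  have kB: "\<bar>k n x\<bar> \<le> B" for n x using B[of x] by (auto simp: k_def)
  have AE: "AE x in ?M. (\<lambda>n. (f x - k n x)\<^sup>2) \<longlonglongrightarrow> 0"
  proof -
    have "AE x in lebesgue. x \<notin> N"
      using N by (intro AE_not_in) (simp add: negligible_iff_null_sets)
    then have "AE x in lborel. x \<notin> N" by (simp add: AE_completion_iff)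
    then have "AE x in lborel. x \<in> {a..b} \<longrightarrow> (\<lambda>n. (f x - k n x)\<^sup>2) \<longlonglongrightarrow> 0"
    proof eventually_elim
      case (elim x)
      show ?case
      proof
        assume "x \<in> {a..b}"
        then have "(\<lambda>n. g n x) \<longlonglongrightarrow> f x" using lim[OF elim] by simp
        then have "(\<lambda>n. (f x - k n x)\<^sup>2) \<longlonglongrightarrow> (f x - max (- B) (min B (f x)))\<^sup>2"
          unfolding k_def by (intro tendsto_intros)
        moreover have "max (- B) (min B (f x)) = f x" using B[of x] by auto
        ultimately show "(\<lambda>n. (f x - k n x)\<^sup>2) \<longlonglongrightarrow> 0" by simp
      qed
    qed
    then show ?thesis by (simp add: AE_restrict_space_iff)
  qed
  have le: "(f x - k n x)\<^sup>2 \<le> (2 * B)\<^sup>2" for n x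
    using B[of x] kB[of n x] by (intro iffD1[OF abs_le_square_iff]) auto
  have meas: "(\<lambda>x. (f x - k n x)\<^sup>2) \<in> borel_measurable ?M" for n
    by (rule borel_measurable_restrict_lborel) measurable
  have int: "integrable ?M (\<lambda>x. (f x - k n x)\<^sup>2)" for n
    by (rule integrable_const_bound[where B = "(2 * B)\<^sup>2"]) (use le meas in auto)
  have "(\<lambda>n. LINT x|?M. (f x - k n x)\<^sup>2) \<longlonglongrightarrow> (LINT x|?M. 0)"
    by (rule integral_dominated_convergence[where w = "\<lambda>_. (2 * B)\<^sup>2"]) (use AE le meas in auto)
  then have "\<forall>\<^sub>F n in sequentially. (LINT x|?M. (f x - k n x)\<^sup>2) < e / 4"
    by (rule order_tendstoD) (use e in simp)
  then obtain n where n: "(LINT x|?M. (f x - k n x)\<^sup>2) < e / 4"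
    by (auto simp: eventually_sequentially)
  obtain p where p: "integrable ?M (\<lambda>x. (k n x - poly p x)\<^sup>2)" "(LINT x|?M. (k n x - poly p x)\<^sup>2) < e / 4"
  proof -
    have "e / 4 > 0" using e by simp
    from continuous_approx_polynomial_L2[OF k this] show ?thesis using that by blast
  qed
  have "f \<in> borel_measurable ?M" "poly p \<in> borel_measurable ?M"
    by (intro borel_measurable_restrict_lborel; simp add: f)+
  from square_distance_triangle[OF this int[of n] p(1)] show ?thesis
    using n p(2) by (intro exI[of _ p] conjI) auto
qed

text \<open>Truncation of the values at height n reduces this to bounded functions; the squared
  errors are dominated by the square of \<open>f\<close>.\<close>

lemma approx_polynomial_L2:
  fixes f :: "real \<Rightarrow> real"
  assumes f: "f \<in> borel_measurable borel"
    and fsq: "integrable (restrict_space lborel {a..b}) (\<lambda>x. (f x)\<^sup>2)" and e: "e > 0"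
  shows "\<exists>p. integrable (restrict_space lborel {a..b}) (\<lambda>x. (f x - poly p x)\<^sup>2)
    \<and> (LINT x|restrict_space lborel {a..b}. (f x - poly p x)\<^sup>2) < e"
proof -
  let ?M = "restrict_space lborel {a..b}"
  note f[measurable]
  define k where "k n x = max (- real n) (min (real n) (f x))" for n x
  have [measurable]: "k n \<in> borel_measurable borel" for n
    unfolding k_def by measurable
  have le: "(f x - k n x)\<^sup>2 \<le> (f x)\<^sup>2" for n x
    by (intro iffD1[OF abs_le_square_iff]) (auto simp: k_def)
  have meas: "(\<lambda>x. (f x - k n x)\<^sup>2) \<in> borel_measurable ?M" for n
    by (rule borel_measurable_restrict_lborel) measurable
  have int: "integrable ?M (\<lambda>x. (f x - k n x)\<^sup>2)" for n
    by (rule Bochner_Integration.integrable_bound[OF fsq]) (use le meas in auto)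
  have "(\<lambda>n. LINT x|?M. (f x - k n x)\<^sup>2) \<longlonglongrightarrow> (LINT x|?M. 0)"
  proof (rule integral_dominated_convergence[OF _ _ fsq])
    show "AE x in ?M. (\<lambda>n. (f x - k n x)\<^sup>2) \<longlonglongrightarrow> 0"
    proof (rule AE_I2, rule tendsto_eventually)
      fix x
      obtain m where m: "\<bar>f x\<bar> \<le> real m" using real_arch_simple by blast
      show "\<forall>\<^sub>F n in sequentially. (f x - k n x)\<^sup>2 = 0"
        using eventually_ge_at_top[of m] by eventually_elim (use m in \<open>auto simp: k_def\<close>)
    qed
  qed (use le meas in auto)
  then have "\<forall>\<^sub>F n in sequentially. (LINT x|?M. (f x - k n x)\<^sup>2) < e / 4"
    by (rule order_tendstoD) (use e in simp)
  then obtain n where n: "(LINT x|?M. (f x - k n x)\<^sup>2) < e / 4"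
    by (auto simp: eventually_sequentially)
  obtain p where p: "integrable ?M (\<lambda>x. (k n x - poly p x)\<^sup>2)" "(LINT x|?M. (k n x - poly p x)\<^sup>2) < e / 4"
  proof -
    have "e / 4 > 0" using e by simp
    moreover have "\<bar>k n x\<bar> \<le> real n" for x by (auto simp: k_def)
    ultimately show ?thesis using bounded_approx_polynomial_L2[of "k n" "real n" "e / 4"] that by auto
  qed
  have "f \<in> borel_measurable ?M" "poly p \<in> borel_measurable ?M"
    by (intro borel_measurable_restrict_lborel; simp add: f)+
  from square_distance_triangle[OF this int[of n] p(1)] show ?thesis
    using n p(2) by (intro exI[of _ p] conjI) auto
qed

section \<open>Parseval's identity for the Legendre system on [-pi, pi]\<close>

abbreviation lborel_pi :: "real measure" where
  "lborel_pi \<equiv> restrict_space lborel {-pi..pi}"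

lemma integrable_lborel_pi_poly: "integrable lborel_pi (poly p)"
  using set_integrable_poly[of "-pi" pi p]
  by (subst integrable_restrict_space) (auto simp: set_integrable_def)

lemma integrable_lborel_pi_poly_mult: "integrable lborel_pi (\<lambda>\<omega>. poly p \<omega> * poly q \<omega>)"
  unfolding poly_mult[symmetric] by (rule integrable_lborel_pi_poly)

lemma PL_orthonormal_lborel_pi:
  "(LINT \<omega>|lborel_pi. poly (PL n) \<omega> * poly (PL m) \<omega>) = (if n = m then 2 * pi else 0)"
  using PL_orthonormal[of n m]
  by (subst integral_restrict_space) (auto simp: set_lebesgue_integral_def)

text \<open>Completing squares gives the distance of \<open>\<phi>\<close> from any combination of
  the \<open>PL n\<close> (\<open>expand\<close>). The optimal coefficients
  \<open>c n / (2 * pi)\<close> yield Bessel's inequality; an arbitrary good polynomial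
  approximation, whose error is at least the optimal one, yields the converse.\<close>

lemma PL_parseval_square:
  fixes \<phi> :: "real \<Rightarrow> real"
  assumes \<phi>: "\<phi> \<in> borel_measurable borel" and \<phi>sq: "integrable lborel_pi (\<lambda>\<omega>. (\<phi> \<omega>)\<^sup>2)"
  shows "(\<lambda>n. (LINT \<omega>|lborel_pi. poly (PL n) \<omega> * \<phi> \<omega>)\<^sup>2) sums (2 * pi * (LINT \<omega>|lborel_pi. (\<phi> \<omega>)\<^sup>2))"
proof -
  define c where "c n = (LINT \<omega>|lborel_pi. poly (PL n) \<omega> * \<phi> \<omega>)" for n
  define I where "I = (LINT \<omega>|lborel_pi. (\<phi> \<omega>)\<^sup>2)"
  define S where "S N = (\<Sum>n<N. (c n)\<^sup>2)" for N
  have meas: "\<phi> \<in> borel_measurable lborel_pi" "poly p \<in> borel_measurable lborel_pi" for p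
    by (intro borel_measurable_restrict_lborel; simp add: \<phi>)+
  have int2: "integrable lborel_pi (\<lambda>\<omega>. poly p \<omega> * poly q \<omega>)" for p q
    by (rule integrable_lborel_pi_poly_mult)
  have intsq: "integrable lborel_pi (\<lambda>\<omega>. (poly p \<omega>)\<^sup>2)" for p
    using int2[of p p] by (simp add: power2_eq_square)
  have int1: "integrable lborel_pi (\<lambda>\<omega>. poly p \<omega> * \<phi> \<omega>)" for p
    by (rule integrable_mult_of_squares[OF meas(2,1) intsq \<phi>sq])
  have expand: "(LINT \<omega>|lborel_pi. (\<phi> \<omega> - poly (\<Sum>n<N. smult (a n) (PL n)) \<omega>)\<^sup>2)
      = I - S N / (2 * pi) + 2 * pi * (\<Sum>n<N. (a n - c n / (2 * pi))\<^sup>2)" for N a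
  proof -
    let ?q = "\<Sum>n<N. smult (a n) (PL n)"
    have q\<phi>: "(LINT \<omega>|lborel_pi. poly ?q \<omega> * \<phi> \<omega>) = (\<Sum>n<N. a n * c n)"
    proof -
      have "(LINT \<omega>|lborel_pi. poly ?q \<omega> * \<phi> \<omega>) = (LINT \<omega>|lborel_pi. (\<Sum>n<N. a n * (poly (PL n) \<omega> * \<phi> \<omega>)))"
        by (simp add: poly_sum sum_distrib_right mult.assoc)
      also have "\<dots> = (\<Sum>n<N. a n * c n)"
        unfolding c_def using int1 by (subst Bochner_Integration.integral_sum) auto
      finally show ?thesis .
    qed
    have qq: "(LINT \<omega>|lborel_pi. (poly ?q \<omega>)\<^sup>2) = (\<Sum>n<N. 2 * pi * (a n)\<^sup>2)"
    proof -
      have "(LINT \<omega>|lborel_pi. (poly ?q \<omega>)\<^sup>2)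
          = (LINT \<omega>|lborel_pi. (\<Sum>n<N. \<Sum>m<N. a n * a m * (poly (PL n) \<omega> * poly (PL m) \<omega>)))"
        by (simp add: poly_sum power2_eq_square sum_product mult_ac)
      also have "\<dots> = (\<Sum>n<N. \<Sum>m<N. a n * a m * (LINT \<omega>|lborel_pi. poly (PL n) \<omega> * poly (PL m) \<omega>))"
        using int2 by (subst Bochner_Integration.integral_sum)
          (auto intro!: Bochner_Integration.integrable_sum sum.cong simp: Bochner_Integration.integral_sum)
      also have "\<dots> = (\<Sum>n<N. 2 * pi * (a n)\<^sup>2)"
        unfolding PL_orthonormal_lborel_pi
        by (intro sum.cong refl) (simp add: if_distrib power2_eq_square cong: if_cong)
      finally show ?thesis .
    qed
    have "(LINT \<omega>|lborel_pi. (\<phi> \<omega> - poly ?q \<omega>)\<^sup>2)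
        = (LINT \<omega>|lborel_pi. (\<phi> \<omega>)\<^sup>2 - 2 * (poly ?q \<omega> * \<phi> \<omega>) + (poly ?q \<omega>)\<^sup>2)"
      by (rule Bochner_Integration.integral_cong) (auto simp: power2_eq_square algebra_simps)
    also have "\<dots> = I - 2 * (\<Sum>n<N. a n * c n) + (\<Sum>n<N. 2 * pi * (a n)\<^sup>2)"
      unfolding q\<phi>[symmetric] qq[symmetric] I_def using \<phi>sq int1[of ?q] intsq[of ?q] by simp
    also have "\<dots> = I + (\<Sum>n<N. 2 * pi * (a n)\<^sup>2 - 2 * (a n * c n))"
      by (simp add: sum_subtractf sum_distrib_left)
    also have "(\<Sum>n<N. 2 * pi * (a n)\<^sup>2 - 2 * (a n * c n))
        = (\<Sum>n<N. 2 * pi * (a n - c n / (2 * pi))\<^sup>2 - (c n)\<^sup>2 / (2 * pi))"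
      by (intro sum.cong refl) (simp add: field_simps power2_eq_square)
    finally show ?thesis
      by (simp add: S_def sum_subtractf sum_distrib_left sum_divide_distrib)
  qed
  have upper: "S N \<le> 2 * pi * I" for N
  proof -
    have "0 \<le> (LINT \<omega>|lborel_pi. (\<phi> \<omega> - poly (\<Sum>n<N. smult (c n / (2 * pi)) (PL n)) \<omega>)\<^sup>2)"
      by simp
    then have "S N / (2 * pi) \<le> I" unfolding expand by simp
    then show ?thesis by (simp add: field_simps)
  qed
  have mono: "S N \<le> S N'" if "N \<le> N'" for N N'
    unfolding S_def using that by (intro sum_mono2) auto
  have "S \<longlonglongrightarrow> 2 * pi * I"
  proof (rule LIMSEQ_I)
    fix e :: real assume e: "e > 0"
    obtain p where p: "(LINT \<omega>|lborel_pi. (\<phi> \<omega> - poly p \<omega>)\<^sup>2) < e / (2 * pi)"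
      using approx_polynomial_L2[OF \<phi> \<phi>sq, of "e / (2 * pi)"] e by auto
    \<comment> \<open>A polynomial is a combination of finitely many \<open>PL n\<close>, so
      \<open>expand\<close> applies to it; dropping its nonnegative last sum bounds the defect of
      the partial sum.\<close>
    obtain a where a: "p = (\<Sum>n<Suc (degree p). smult (a n) (PL n))"
      using poly_in_span_PL[of p "Suc (degree p)"] by auto
    have "0 \<le> (\<Sum>n<Suc (degree p). (a n - c n / (2 * pi))\<^sup>2)" by (intro sum_nonneg) auto
    then have "I - S (Suc (degree p)) / (2 * pi) < e / (2 * pi)"
      using p expand[of a "Suc (degree p)", folded a] by (smt (verit) mult_nonneg_nonneg pi_ge_zero)
    then have "(I - S (Suc (degree p)) / (2 * pi)) * (2 * pi) < e / (2 * pi) * (2 * pi)"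
      by (rule mult_strict_right_mono) simp
    moreover have "(I - S (Suc (degree p)) / (2 * pi)) * (2 * pi) = 2 * pi * I - S (Suc (degree p))"
      by (simp add: left_diff_distrib)
    moreover have "e / (2 * pi) * (2 * pi) = e" by simp
    ultimately have *: "2 * pi * I - S (Suc (degree p)) < e" by linarith
    show "\<exists>no. \<forall>n\<ge>no. norm (S n - 2 * pi * I) < e"
    proof (intro exI allI impI)
      fix n assume "n \<ge> Suc (degree p)"
      from mono[OF this] upper[of n] * show "norm (S n - 2 * pi * I) < e" by simp
    qed
  qed
  then show ?thesis
    by (simp add: sums_def S_def[abs_def] c_def I_def)
qed

text \<open>Polarization: the square case is applied to the sum and the difference of the two
  functions.\<close>

lemma PL_parseval_real:
  fixes \<phi> \<psi> :: "real \<Rightarrow> real"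
  assumes \<phi>: "\<phi> \<in> borel_measurable borel" "integrable lborel_pi (\<lambda>\<omega>. (\<phi> \<omega>)\<^sup>2)"
    and \<psi>: "\<psi> \<in> borel_measurable borel" "integrable lborel_pi (\<lambda>\<omega>. (\<psi> \<omega>)\<^sup>2)"
  shows "(\<lambda>n. (LINT \<omega>|lborel_pi. poly (PL n) \<omega> * \<phi> \<omega>) * (LINT \<omega>|lborel_pi. poly (PL n) \<omega> * \<psi> \<omega>))
    sums (2 * pi * (LINT \<omega>|lborel_pi. \<phi> \<omega> * \<psi> \<omega>))"
proof -
  have meas: "\<phi> \<in> borel_measurable lborel_pi" "\<psi> \<in> borel_measurable lborel_pi"
    "poly p \<in> borel_measurable lborel_pi" for p
    by (intro borel_measurable_restrict_lborel; simp add: \<phi> \<psi>)+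
  have psq: "integrable lborel_pi (\<lambda>\<omega>. (poly p \<omega>)\<^sup>2)" for p
    using integrable_lborel_pi_poly_mult[of p p] by (simp add: power2_eq_square)
  have int: "integrable lborel_pi (\<lambda>\<omega>. poly p \<omega> * \<phi> \<omega>)" "integrable lborel_pi (\<lambda>\<omega>. poly p \<omega> * \<psi> \<omega>)" for p
    by (rule integrable_mult_of_squares; use meas psq \<phi> \<psi> in simp)+
  have prod: "integrable lborel_pi (\<lambda>\<omega>. \<phi> \<omega> * \<psi> \<omega>)"
    by (rule integrable_mult_of_squares; use meas \<phi> \<psi> in simp)
  have eq: "(\<phi> \<omega> + \<psi> \<omega>)\<^sup>2 = (\<phi> \<omega>)\<^sup>2 + 2 * (\<phi> \<omega> * \<psi> \<omega>) + (\<psi> \<omega>)\<^sup>2"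
     "(\<phi> \<omega> - \<psi> \<omega>)\<^sup>2 = (\<phi> \<omega>)\<^sup>2 - 2 * (\<phi> \<omega> * \<psi> \<omega>) + (\<psi> \<omega>)\<^sup>2" for \<omega>
    by (simp_all add: power2_eq_square algebra_simps)
  have "integrable lborel_pi (\<lambda>\<omega>. (\<phi> \<omega> + \<psi> \<omega>)\<^sup>2)" "integrable lborel_pi (\<lambda>\<omega>. (\<phi> \<omega> - \<psi> \<omega>)\<^sup>2)"
    unfolding eq using \<phi> \<psi> prod by auto
  then have polar: "(\<lambda>n. 1 / 4 * ((LINT \<omega>|lborel_pi. poly (PL n) \<omega> * (\<phi> \<omega> + \<psi> \<omega>))\<^sup>2 - (LINT \<omega>|lborel_pi. poly (PL n) \<omega> * (\<phi> \<omega> - \<psi> \<omega>))\<^sup>2))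
    sums (1 / 4 * (2 * pi * (LINT \<omega>|lborel_pi. (\<phi> \<omega> + \<psi> \<omega>)\<^sup>2) - 2 * pi * (LINT \<omega>|lborel_pi. (\<phi> \<omega> - \<psi> \<omega>)\<^sup>2)))"
    using \<phi> \<psi> by (intro sums_mult sums_diff PL_parseval_square) auto
  have sq: "(LINT \<omega>|lborel_pi. (\<phi> \<omega> + \<psi> \<omega>)\<^sup>2)
      = (LINT \<omega>|lborel_pi. (\<phi> \<omega>)\<^sup>2) + 2 * (LINT \<omega>|lborel_pi. \<phi> \<omega> * \<psi> \<omega>) + (LINT \<omega>|lborel_pi. (\<psi> \<omega>)\<^sup>2)"
    "(LINT \<omega>|lborel_pi. (\<phi> \<omega> - \<psi> \<omega>)\<^sup>2)
      = (LINT \<omega>|lborel_pi. (\<phi> \<omega>)\<^sup>2) - 2 * (LINT \<omega>|lborel_pi. \<phi> \<omega> * \<psi> \<omega>) + (LINT \<omega>|lborel_pi. (\<psi> \<omega>)\<^sup>2)"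
    unfolding eq using \<phi> \<psi> prod by simp_all
  have coeff: "1 / 4 * ((LINT \<omega>|lborel_pi. poly p \<omega> * (\<phi> \<omega> + \<psi> \<omega>))\<^sup>2 - (LINT \<omega>|lborel_pi. poly p \<omega> * (\<phi> \<omega> - \<psi> \<omega>))\<^sup>2)
      = (LINT \<omega>|lborel_pi. poly p \<omega> * \<phi> \<omega>) * (LINT \<omega>|lborel_pi. poly p \<omega> * \<psi> \<omega>)" for p
    using int by (simp add: distrib_left right_diff_distrib power2_eq_square algebra_simps)
  have val: "1 / 4 * (2 * pi * (x + 2 * y + z) - 2 * pi * (x - 2 * y + z)) = 2 * pi * y" for x y z
    by (simp add: algebra_simps)
  show ?thesis using polar unfolding sq coeff val .
qed

text \<open>The identity is bilinear, without conjugation. Splitting both functions into real and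
  imaginary parts therefore reduces it to four real series.\<close>

lemma PL_parseval:
  fixes \<phi> \<psi> :: "real \<Rightarrow> complex"
  assumes \<phi>: "square_integrable \<phi>" and \<psi>: "square_integrable \<psi>"
  shows "(\<lambda>n. (LINT \<omega>|lborel_pi. of_real (poly (PL n) \<omega>) * \<phi> \<omega>) * (LINT \<omega>|lborel_pi. of_real (poly (PL n) \<omega>) * \<psi> \<omega>))
    sums (2 * pi * (LINT \<omega>|lborel_pi. \<phi> \<omega> * \<psi> \<omega>))"
proof -
  let ?c = "\<lambda>n (f :: real \<Rightarrow> real). LINT \<omega>|lborel_pi. poly (PL n) \<omega> * f \<omega>"
  have psq: "integrable lborel_pi (\<lambda>\<omega>. (poly p \<omega>)\<^sup>2)" for p
    using integrable_lborel_pi_poly_mult[of p p] by (simp add: power2_eq_square)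
  have parts: "r \<in> borel_measurable borel \<and> integrable lborel_pi (\<lambda>\<omega>. (r \<omega>)\<^sup>2)"
    if f: "square_integrable f" and r: "r = (\<lambda>\<omega>. Re (f \<omega>)) \<or> r = (\<lambda>\<omega>. Im (f \<omega>))" for f r
  proof -
    have r_meas: "r \<in> borel_measurable borel"
      using f r by (auto simp: square_integrable_def)
    have "integrable lborel (\<lambda>\<omega>. (r \<omega>)\<^sup>2)"
    proof (rule Bochner_Integration.integrable_bound)
      show "integrable lborel (\<lambda>\<omega>. (norm (f \<omega>))\<^sup>2)" using f by (simp add: square_integrable_def)
      show "AE \<omega> in lborel. norm ((r \<omega>)\<^sup>2) \<le> norm ((norm (f \<omega>))\<^sup>2)"
        using r by (auto simp: cmod_power2)
    qed (use r_meas in auto)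
    then have "integrable lborel_pi (\<lambda>\<omega>. (r \<omega>)\<^sup>2)"
      using integrable_mult_indicator[of "{-pi..pi}" lborel "\<lambda>\<omega>. (r \<omega>)\<^sup>2"]
      by (subst integrable_restrict_space) auto
    with r_meas show ?thesis by simp
  qed
  define a b c d where "a \<omega> = Re (\<phi> \<omega>)" and "b \<omega> = Im (\<phi> \<omega>)" and "c \<omega> = Re (\<psi> \<omega>)" and "d \<omega> = Im (\<psi> \<omega>)" for \<omega>
  have a: "a \<in> borel_measurable borel" "integrable lborel_pi (\<lambda>\<omega>. (a \<omega>)\<^sup>2)"
    using parts[OF \<phi>, of a] by (auto simp: a_def[abs_def])
  have b: "b \<in> borel_measurable borel" "integrable lborel_pi (\<lambda>\<omega>. (b \<omega>)\<^sup>2)"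
    using parts[OF \<phi>, of b] by (auto simp: b_def[abs_def])
  have c: "c \<in> borel_measurable borel" "integrable lborel_pi (\<lambda>\<omega>. (c \<omega>)\<^sup>2)"
    using parts[OF \<psi>, of c] by (auto simp: c_def[abs_def])
  have d: "d \<in> borel_measurable borel" "integrable lborel_pi (\<lambda>\<omega>. (d \<omega>)\<^sup>2)"
    using parts[OF \<psi>, of d] by (auto simp: d_def[abs_def])
  have mulint: "integrable lborel_pi (\<lambda>\<omega>. r \<omega> * s \<omega>)"
    if "r \<in> borel_measurable borel" "integrable lborel_pi (\<lambda>\<omega>. (r \<omega>)\<^sup>2)"
       "s \<in> borel_measurable borel" "integrable lborel_pi (\<lambda>\<omega>. (s \<omega>)\<^sup>2)" for r s :: "real \<Rightarrow> real"
    using that by (intro integrable_mult_of_squares borel_measurable_restrict_lborel) auto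
  have \<phi>_eq: "\<phi> \<omega> = of_real (a \<omega>) + \<i> * of_real (b \<omega>)" for \<omega>
    by (simp add: a_def b_def complex_eq_iff)
  have \<psi>_eq: "\<psi> \<omega> = of_real (c \<omega>) + \<i> * of_real (d \<omega>)" for \<omega>
    by (simp add: c_def d_def complex_eq_iff)
  have coeff: "(LINT \<omega>|lborel_pi. of_real (poly (PL n) \<omega>) * (of_real (r \<omega>) + \<i> * of_real (s \<omega>)))
      = of_real (?c n r) + \<i> * of_real (?c n s)"
    if "r \<in> borel_measurable borel" "integrable lborel_pi (\<lambda>\<omega>. (r \<omega>)\<^sup>2)"
       "s \<in> borel_measurable borel" "integrable lborel_pi (\<lambda>\<omega>. (s \<omega>)\<^sup>2)" for n r s
  proof -
    have "integrable lborel_pi (\<lambda>\<omega>. complex_of_real (poly (PL n) \<omega> * r \<omega>))"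
      "integrable lborel_pi (\<lambda>\<omega>. complex_of_real (poly (PL n) \<omega> * s \<omega>))"
      using that psq by (intro integrable_of_real mulint; simp)+
    then show ?thesis
      by (simp add: distrib_left mult.left_commute[of _ \<i>] flip: of_real_mult)
  qed
  have prod: "(LINT \<omega>|lborel_pi. \<phi> \<omega> * \<psi> \<omega>)
      = of_real ((LINT \<omega>|lborel_pi. a \<omega> * c \<omega>) - (LINT \<omega>|lborel_pi. b \<omega> * d \<omega>))
        + \<i> * of_real ((LINT \<omega>|lborel_pi. a \<omega> * d \<omega>) + (LINT \<omega>|lborel_pi. b \<omega> * c \<omega>))"
  proof -
    have eq: "\<phi> \<omega> * \<psi> \<omega> = of_real (a \<omega> * c \<omega> - b \<omega> * d \<omega>) + \<i> * of_real (a \<omega> * d \<omega> + b \<omega> * c \<omega>)" for \<omega>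
      by (simp add: \<phi>_eq \<psi>_eq algebra_simps)
    have 1: "integrable lborel_pi (\<lambda>\<omega>. a \<omega> * c \<omega> - b \<omega> * d \<omega>)" "integrable lborel_pi (\<lambda>\<omega>. a \<omega> * d \<omega> + b \<omega> * c \<omega>)"
      using a b c d by (auto intro!: mulint)
    have "(LINT \<omega>|lborel_pi. \<phi> \<omega> * \<psi> \<omega>)
        = of_real (LINT \<omega>|lborel_pi. a \<omega> * c \<omega> - b \<omega> * d \<omega>) + \<i> * of_real (LINT \<omega>|lborel_pi. a \<omega> * d \<omega> + b \<omega> * c \<omega>)"
      unfolding eq using 1[THEN integrable_of_real, where 'a = complex]
      by (subst Bochner_Integration.integral_add) (simp_all del: of_real_diff of_real_add)
    then show ?thesis using a b c d mulint by simp
  qed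
  have series: "(\<lambda>n. of_real (?c n a * ?c n c - ?c n b * ?c n d) + \<i> * of_real (?c n a * ?c n d + ?c n b * ?c n c))
    sums (of_real (2 * pi * (LINT \<omega>|lborel_pi. a \<omega> * c \<omega>) - 2 * pi * (LINT \<omega>|lborel_pi. b \<omega> * d \<omega>))
     + \<i> * of_real (2 * pi * (LINT \<omega>|lborel_pi. a \<omega> * d \<omega>) + 2 * pi * (LINT \<omega>|lborel_pi. b \<omega> * c \<omega>)))"
    using a b c d by (intro sums_add sums_diff sums_mult sums_of_real PL_parseval_real) auto
  have summand: "(LINT \<omega>|lborel_pi. of_real (poly (PL n) \<omega>) * \<phi> \<omega>) * (LINT \<omega>|lborel_pi. of_real (poly (PL n) \<omega>) * \<psi> \<omega>)
     = of_real (?c n a * ?c n c - ?c n b * ?c n d) + \<i> * of_real (?c n a * ?c n d + ?c n b * ?c n c)" for n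
    unfolding \<phi>_eq \<psi>_eq coeff[OF a b] coeff[OF c d] by (simp add: algebra_simps)
  have "of_real (2 * pi * x - 2 * pi * y) + \<i> * of_real (2 * pi * z + 2 * pi * w)
      = complex_of_real (2 * pi) * (of_real (x - y) + \<i> * of_real (z + w))" for x y z w
    by (simp add: algebra_simps)
  from series[unfolded this] show ?thesis
    unfolding summand prod .
qed

section \<open>Bandlimited functions\<close>

lemma integrable_mult_bounded_on_support:
  fixes F c :: "real \<Rightarrow> complex"
  assumes F: "integrable lborel F" and c: "c \<in> borel_measurable borel"
    and B: "\<And>\<omega>. F \<omega> \<noteq> 0 \<Longrightarrow> norm (c \<omega>) \<le> B"
  shows "integrable lborel (\<lambda>\<omega>. c \<omega> * F \<omega>)"
proof (rule Bochner_Integration.integrable_bound)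
  show "integrable lborel (\<lambda>\<omega>. B * norm (F \<omega>))" using F by auto
  have "norm (c \<omega> * F \<omega>) \<le> norm (B * norm (F \<omega>))" for \<omega>
    using B[of \<omega>] by (cases "F \<omega> = 0") (auto simp: norm_mult abs_mult intro: order.trans[OF _ abs_ge_self])
  then show "AE \<omega> in lborel. norm (c \<omega> * F \<omega>) \<le> norm (B * norm (F \<omega>))" by simp
qed (use F c in auto)

text \<open>The first-order Taylor remainder of the exponential is at most (\<open>\<omega>\<close>
  h)^2 / 2, hence at most s^2 h^2 / 2 on the support. Integrating against \<open>F\<close> gives an
  error of order h^2 for the difference.\<close>

lemma has_vector_derivative_bandlimited:
  assumes F: "integrable lborel F" and supp: "\<And>\<omega>. \<omega> \<notin> {-s..s} \<Longrightarrow> F \<omega> = 0"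
  shows "((\<lambda>t. LINT \<omega>|lborel. F \<omega> * exp (\<i> * of_real \<omega> * of_real t)) has_vector_derivative
    (LINT \<omega>|lborel. (\<i> * of_real \<omega> * F \<omega>) * exp (\<i> * of_real \<omega> * of_real t))) (at t)"
proof -
  let ?e = "\<lambda>\<omega> t. exp (\<i> * of_real \<omega> * of_real t) :: complex"
  let ?f = "\<lambda>t. LINT \<omega>|lborel. F \<omega> * ?e \<omega> t"
  let ?D = "LINT \<omega>|lborel. (\<i> * of_real \<omega> * F \<omega>) * ?e \<omega> t"
  define C where "C = s\<^sup>2 / 2 * (LINT \<omega>|lborel. norm (F \<omega>))"
  have norm_e: "norm (?e \<omega> t) = 1" for \<omega> t by (simp add: norm_exp_eq_Re)
  have intF: "integrable lborel (\<lambda>\<omega>. F \<omega> * ?e \<omega> t)" for t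
    by (subst mult.commute, rule integrable_mult_bounded_on_support[OF F, where B = 1]) (auto simp: norm_e)
  have intD: "integrable lborel (\<lambda>\<omega>. (\<i> * of_real \<omega> * F \<omega>) * ?e \<omega> t)"
  proof -
    have "integrable lborel (\<lambda>\<omega>. (\<i> * of_real \<omega> * ?e \<omega> t) * F \<omega>)"
    proof (rule integrable_mult_bounded_on_support[OF F, where B = s])
      show "norm (\<i> * of_real \<omega> * ?e \<omega> t) \<le> s" if "F \<omega> \<noteq> 0" for \<omega>
        unfolding norm_mult norm_e using supp[of \<omega>] that by force
    qed measurable
    then show ?thesis by (simp add: mult_ac)
  qed
  have bound: "norm (?f (t + h) - ?f t - h *\<^sub>R ?D) \<le> C * h\<^sup>2" for h
  proof -
    have rem: "norm (?e \<omega> h - 1 - \<i> * of_real \<omega> * of_real h) \<le> (\<omega> * h)\<^sup>2 / 2" for \<omega>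
      using iexp_approx1[of "\<omega> * h" 1] by (simp add: mult.assoc power2_eq_square abs_mult_self_eq algebra_simps flip: abs_mult)
    have "?f (t + h) - ?f t - h *\<^sub>R ?D
        = (LINT \<omega>|lborel. F \<omega> * ?e \<omega> (t + h) - F \<omega> * ?e \<omega> t - h *\<^sub>R ((\<i> * of_real \<omega> * F \<omega>) * ?e \<omega> t))"
      using intF[of "t + h"] intF[of t] intD by (simp del: of_real_add)
    also have "\<dots> = (LINT \<omega>|lborel. F \<omega> * ?e \<omega> t * (?e \<omega> h - 1 - \<i> * of_real \<omega> * of_real h))"
      by (rule Bochner_Integration.integral_cong) (simp_all add: scaleR_conv_of_real algebra_simps exp_add)
    also have "norm \<dots> \<le> (LINT \<omega>|lborel. s\<^sup>2 * h\<^sup>2 / 2 * norm (F \<omega>))"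
    proof (rule Bochner_Integration.integral_norm_bound_integral)
      show "integrable lborel (\<lambda>\<omega>. F \<omega> * ?e \<omega> t * (?e \<omega> h - 1 - \<i> * of_real \<omega> * of_real h))"
      proof -
        have "integrable lborel (\<lambda>\<omega>. F \<omega> * ?e \<omega> (t + h) - F \<omega> * ?e \<omega> t - h *\<^sub>R ((\<i> * of_real \<omega> * F \<omega>) * ?e \<omega> t))"
          using intF intD by (intro Bochner_Integration.integrable_diff integrable_scaleR_right intF intD)
        then show ?thesis
          by (rule Bochner_Integration.integrable_cong[THEN iffD1, rotated -1])
             (simp_all add: scaleR_conv_of_real algebra_simps exp_add)
      qed
      show "integrable lborel (\<lambda>\<omega>. s\<^sup>2 * h\<^sup>2 / 2 * norm (F \<omega>))" using F by auto
      show "norm (F \<omega> * ?e \<omega> t * (?e \<omega> h - 1 - \<i> * of_real \<omega> * of_real h)) \<le> s\<^sup>2 * h\<^sup>2 / 2 * norm (F \<omega>)" for \<omega>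
      proof (cases "F \<omega> = 0")
        case False
        then have "\<omega>\<^sup>2 \<le> s\<^sup>2" using supp[of \<omega>] by (force simp: abs_le_square_iff[symmetric])
        then have "(\<omega> * h)\<^sup>2 / 2 \<le> s\<^sup>2 * h\<^sup>2 / 2"
          by (simp add: power_mult_distrib mult_right_mono)
        with rem[of \<omega>] have "norm (?e \<omega> h - 1 - \<i> * of_real \<omega> * of_real h) \<le> s\<^sup>2 * h\<^sup>2 / 2"
          by linarith
        then have "norm (F \<omega>) * norm (?e \<omega> h - 1 - \<i> * of_real \<omega> * of_real h) \<le> norm (F \<omega>) * (s\<^sup>2 * h\<^sup>2 / 2)"
          by (rule mult_left_mono) simp
        then show ?thesis
          by (simp only: norm_mult norm_e mult_1_right mult.commute[of "s\<^sup>2 * h\<^sup>2 / 2"])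
      qed simp
    qed
    also have "\<dots> = C * h\<^sup>2" by (simp add: C_def)
    finally show ?thesis .
  qed
  have "(\<lambda>h. norm (?f (t + h) - ?f t - h *\<^sub>R ?D) / norm h) \<midarrow>0\<rightarrow> 0"
  proof (rule Lim_null_comparison)
    \<comment> \<open>At h = 0 both sides are 0, the left one because division by zero is
      zero.\<close>
    have "norm (?f (t + h) - ?f t - h *\<^sub>R ?D) / norm h \<le> C * \<bar>h\<bar>" for h
    proof (cases "h = 0")
      case False
      have "C * h\<^sup>2 = C * \<bar>h\<bar> * \<bar>h\<bar>" by (simp add: power2_eq_square mult.assoc)
      with bound[of h] False show ?thesis by (simp only: divide_le_eq real_norm_def) simp
    qed simp
    then show "\<forall>\<^sub>F h in at 0. norm (norm (?f (t + h) - ?f t - h *\<^sub>R ?D) / norm h) \<le> C * \<bar>h\<bar>"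
      by simp
    have "(\<lambda>h. C * \<bar>h\<bar>) \<midarrow>0\<rightarrow> C * \<bar>0 :: real\<bar>" by (intro tendsto_intros)
    then show "(\<lambda>h. C * \<bar>h\<bar>) \<midarrow>0\<rightarrow> 0" by simp
  qed
  then show ?thesis
    unfolding has_vector_derivative_def has_derivative_at
    by (simp add: bounded_linear_scaleR_left)
qed

text \<open>Multiplication by \<open>\<i> * of_real \<omega>\<close> keeps the spectrum integrable
  and inside the same interval, so the derivative rule can be iterated.\<close>

lemma higher_deriv_bandlimited:
  assumes f: "\<And>t. f t = (LINT \<omega>|lborel. F \<omega> * exp (\<i> * of_real \<omega> * of_real t))"
    and F: "integrable lborel F" and supp: "\<And>\<omega>. \<omega> \<notin> {-s..s} \<Longrightarrow> F \<omega> = 0"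
  shows "integrable lborel (\<lambda>\<omega>. (\<i> * of_real \<omega>) ^ k * F \<omega>)" (is ?I)
    and "higher_deriv k f t = (LINT \<omega>|lborel. (\<i> * of_real \<omega>) ^ k * F \<omega> * exp (\<i> * of_real \<omega> * of_real t))"
proof -
  have int: "integrable lborel (\<lambda>\<omega>. (\<i> * of_real \<omega>) ^ k * F \<omega>)" for k
  proof (rule integrable_mult_bounded_on_support[OF F, where B = "s ^ k"])
    show "norm ((\<i> * complex_of_real \<omega>) ^ k) \<le> s ^ k" if "F \<omega> \<noteq> 0" for \<omega>
      using supp[of \<omega>] that by (force simp: norm_power norm_mult intro!: power_mono)
  qed measurable
  then show ?I .
  show "higher_deriv k f t = (LINT \<omega>|lborel. (\<i> * of_real \<omega>) ^ k * F \<omega> * exp (\<i> * of_real \<omega> * of_real t))"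
  proof (induction k arbitrary: t)
    case 0
    then show ?case by (simp add: higher_deriv_def f)
  next
    case (Suc k)
    have "higher_deriv (Suc k) f t = vector_derivative (higher_deriv k f) (at t)"
      by (simp add: higher_deriv_def)
    also have "higher_deriv k f = (\<lambda>t. LINT \<omega>|lborel. (\<i> * of_real \<omega>) ^ k * F \<omega> * exp (\<i> * of_real \<omega> * of_real t))"
      using Suc.IH by auto
    also have "vector_derivative \<dots> (at t)
        = (LINT \<omega>|lborel. (\<i> * of_real \<omega> * ((\<i> * of_real \<omega>) ^ k * F \<omega>)) * exp (\<i> * of_real \<omega> * of_real t))"
      by (rule vector_derivative_at, rule has_vector_derivative_bandlimited[OF int, of s]) (use supp in auto)
    finally show ?case by (simp add: mult.assoc)
  qed
qed

text \<open>Since i^k (i \<open>\<omega>\<close>)^k = (-\<open>\<omega>\<close>)^k, the polynomial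
  in the operator acts as multiplication by \<open>poly (PL n) (- \<omega>)\<close>. Parity pulls
  out (-1)^n, which combines with (-i)^n to i^n.\<close>

lemma chromatic_deriv_bandlimited:
  assumes f: "\<And>t. f t = (LINT \<omega>|lborel. F \<omega> * exp (\<i> * of_real \<omega> * of_real t))"
    and F: "integrable lborel F" and supp: "\<And>\<omega>. \<omega> \<notin> {-s..s} \<Longrightarrow> F \<omega> = 0"
  shows "chromatic_deriv n f t
     = \<i> ^ n * (LINT \<omega>|lborel. of_real (poly (PL n) \<omega>) * (F \<omega> * exp (\<i> * of_real \<omega> * of_real t)))"
proof -
  let ?e = "\<lambda>\<omega>. exp (\<i> * of_real \<omega> * of_real t) :: complex"
  have int: "integrable lborel (\<lambda>\<omega>. (\<i> * of_real \<omega>) ^ k * F \<omega> * ?e \<omega>)" for k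
    by (subst mult.commute, rule integrable_mult_bounded_on_support[OF higher_deriv_bandlimited(1)[OF f F supp], where B = 1])
       (auto simp: norm_exp_eq_Re)
  have ii: "\<i> ^ k * (\<i> * of_real \<omega>) ^ k = complex_of_real ((- \<omega>) ^ k)" for k \<omega>
    by (simp flip: power_mult_distrib mult.assoc)
  have "(\<Sum>k\<le>degree (PL n). of_real (coeff (PL n) k) * \<i> ^ k * higher_deriv k f t)
      = (\<Sum>k\<le>degree (PL n). LINT \<omega>|lborel. of_real (coeff (PL n) k) * \<i> ^ k * ((\<i> * of_real \<omega>) ^ k * F \<omega> * ?e \<omega>))"
    by (simp only: higher_deriv_bandlimited(2)[OF f F supp] integral_mult_right_zero)
  also have "\<dots> = (LINT \<omega>|lborel. (\<Sum>k\<le>degree (PL n). of_real (coeff (PL n) k) * \<i> ^ k * ((\<i> * of_real \<omega>) ^ k * F \<omega> * ?e \<omega>)))"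
    using int by (subst Bochner_Integration.integral_sum) auto
  also have "\<dots> = (LINT \<omega>|lborel. of_real (poly (PL n) (- \<omega>)) * (F \<omega> * ?e \<omega>))"
  proof (rule Bochner_Integration.integral_cong)
    fix \<omega>
    have "of_real (coeff (PL n) k) * \<i> ^ k * ((\<i> * of_real \<omega>) ^ k * F \<omega> * ?e \<omega>)
        = of_real (coeff (PL n) k * (- \<omega>) ^ k) * (F \<omega> * ?e \<omega>)" for k
      unfolding of_real_mult ii[symmetric] by (simp only: mult_ac)
    then show "(\<Sum>k\<le>degree (PL n). of_real (coeff (PL n) k) * \<i> ^ k * ((\<i> * of_real \<omega>) ^ k * F \<omega> * ?e \<omega>))
        = of_real (poly (PL n) (- \<omega>)) * (F \<omega> * ?e \<omega>)"
      by (simp only: poly_altdef of_real_sum sum_distrib_right)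
  qed simp
  also have "\<dots> = (-1) ^ n * (LINT \<omega>|lborel. of_real (poly (PL n) \<omega>) * (F \<omega> * ?e \<omega>))"
    by (simp add: poly_PL_minus mult.assoc)
  finally have "chromatic_deriv n f t = (- \<i>) ^ n * ((-1) ^ n * (LINT \<omega>|lborel. of_real (poly (PL n) \<omega>) * (F \<omega> * ?e \<omega>)))"
    by (simp only: chromatic_deriv_def)
  then show ?thesis by (simp flip: power_mult_distrib mult.assoc)
qed

section \<open>Parseval's identity for chromatic derivatives\<close>

lemma integral_lborel_pi_eq:
  fixes f :: "real \<Rightarrow> complex"
  assumes "\<And>\<omega>. \<omega> \<notin> {-pi..pi} \<Longrightarrow> f \<omega> = 0"
  shows "(LINT \<omega>|lborel_pi. f \<omega>) = (LINT \<omega>|lborel. f \<omega>)"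
  by (subst integral_restrict_space)
     (use assms in \<open>auto intro!: Bochner_Integration.integral_cong simp: indicator_def\<close>)

text \<open>The hypotheses are asymmetric on purpose. Duality needs an L^2 Fourier transform of
  \<open>f\<close>, whereas \<open>h\<close> enters only through an integral representation with
  spectrum \<open>H\<close>. A reflected and shifted function can thus be inserted for
  \<open>h\<close> without constructing its L^2 transform.\<close>

lemma chromatic_parseval:
  assumes f: "has_L2_fourier_transform f F" "continuous_on UNIV f" "\<And>\<omega>. \<omega> \<notin> {-pi..pi} \<Longrightarrow> F \<omega> = 0"
    and H: "square_integrable H" "\<And>\<omega>. \<omega> \<notin> {-pi..pi} \<Longrightarrow> H \<omega> = 0"
    and h: "square_integrable h" "\<And>x. h x = (LINT \<omega>|lborel. H \<omega> * exp (\<i> * of_real \<omega> * of_real x))"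
  shows "(\<lambda>n. chromatic_deriv n f t * chromatic_deriv n h t) sums (LINT x|lborel. f x * h x)"
proof -
  let ?e = "\<lambda>\<omega> t. exp (\<i> * of_real \<omega> * of_real t) :: complex"
  have Fsq: "square_integrable F" using f(1) by (simp add: has_L2_fourier_transform_def)
  have Fint: "integrable lborel F"
    by (rule square_integrable_zero_outside_integrable[OF Fsq f(3)])
  \<comment> \<open>Absorbs the factor of the inversion formula, so that \<open>f\<close> and
    \<open>h\<close> are represented in the same way.\<close>
  define F' where "F' \<omega> = 1 / (2 * pi) * F \<omega>" for \<omega>
  have F'0: "F' \<omega> = 0" if "\<omega> \<notin> {-pi..pi}" for \<omega> using f(3)[OF that] by (simp add: F'_def)
  have F'int: "integrable lborel F'" using Fint by (simp add: F'_def[abs_def])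
  have f_eq: "f t = (LINT \<omega>|lborel. F' \<omega> * ?e \<omega> t)" for t
    using L2_fourier_inversion[OF f(1) _ Fint, of t] f(2)
    by (simp add: F'_def continuous_on_eq_continuous_at)
  have Hint: "integrable lborel H"
    by (rule square_integrable_zero_outside_integrable[OF H])
  define \<phi> where "\<phi> \<omega> = F' \<omega> * ?e \<omega> t" for \<omega>
  define \<psi> where "\<psi> \<omega> = H (- \<omega>) * ?e (- \<omega>) t" for \<omega>
  have \<phi>: "square_integrable \<phi>"
    using square_integrable_mult_bounded[OF Fsq, of "\<lambda>\<omega>. 1 / (2 * pi) * ?e \<omega> t" "1 / (2 * pi)"]
    by (simp add: \<phi>_def[abs_def] F'_def norm_exp_eq_Re norm_divide norm_mult mult_ac)
  have Hneg: "square_integrable (\<lambda>\<omega>. H (- \<omega>))"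
    using square_integrable_affine[OF H(1), of "-1" 0] by simp
  have \<psi>: "square_integrable \<psi>"
    using square_integrable_mult_bounded[OF Hneg, of "\<lambda>\<omega>. ?e (- \<omega>) t" 1]
    by (simp add: \<psi>_def[abs_def] norm_exp_eq_Re mult_ac)
  have summand: "chromatic_deriv n f t * chromatic_deriv n h t
      = (LINT \<omega>|lborel_pi. of_real (poly (PL n) \<omega>) * \<phi> \<omega>) * (LINT \<omega>|lborel_pi. of_real (poly (PL n) \<omega>) * \<psi> \<omega>)" for n
  proof -
    have 1: "chromatic_deriv n f t = \<i> ^ n * (LINT \<omega>|lborel_pi. of_real (poly (PL n) \<omega>) * \<phi> \<omega>)"
    proof -
      have "chromatic_deriv n f t = \<i> ^ n * (LINT \<omega>|lborel. of_real (poly (PL n) \<omega>) * (F' \<omega> * ?e \<omega> t))"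
        by (rule chromatic_deriv_bandlimited[OF f_eq F'int F'0])
      then show ?thesis
        unfolding \<phi>_def by (subst integral_lborel_pi_eq) (auto simp: F'0)
    qed
    have "chromatic_deriv n h t = \<i> ^ n * (LINT \<omega>|lborel. of_real (poly (PL n) \<omega>) * (H \<omega> * ?e \<omega> t))"
      by (rule chromatic_deriv_bandlimited[OF h(2) Hint H(2)])
    also have "(LINT \<omega>|lborel. of_real (poly (PL n) \<omega>) * (H \<omega> * ?e \<omega> t))
        = (LINT \<omega>|lborel. of_real (poly (PL n) (- \<omega>)) * \<psi> \<omega>)"
      unfolding \<psi>_def by (subst lborel_integral_real_affine[of "-1" _ 0]) auto
    also have "\<dots> = (-1) ^ n * (LINT \<omega>|lborel. of_real (poly (PL n) \<omega>) * \<psi> \<omega>)"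
      by (simp add: poly_PL_minus mult.assoc)
    also have "(LINT \<omega>|lborel. of_real (poly (PL n) \<omega>) * \<psi> \<omega>) = (LINT \<omega>|lborel_pi. of_real (poly (PL n) \<omega>) * \<psi> \<omega>)"
      by (subst integral_lborel_pi_eq) (auto simp: \<psi>_def H(2))
    finally have 2: "chromatic_deriv n h t = \<i> ^ n * ((-1) ^ n * (LINT \<omega>|lborel_pi. of_real (poly (PL n) \<omega>) * \<psi> \<omega>))" .
    \<comment> \<open>The sign from reflecting the second spectrum exactly cancels the two factors
      i^n.\<close>
    have "\<i> ^ n * \<i> ^ n * (-1) ^ n = (1 :: complex)" by (simp flip: power_mult_distrib)
    then show ?thesis unfolding 1 2 by (simp add: algebra_simps)
  qed
  have "2 * pi * (LINT \<omega>|lborel_pi. \<phi> \<omega> * \<psi> \<omega>) = (LINT \<omega>|lborel. F \<omega> * H (- \<omega>))"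
  proof -
    have "(LINT \<omega>|lborel_pi. \<phi> \<omega> * \<psi> \<omega>) = (LINT \<omega>|lborel. \<phi> \<omega> * \<psi> \<omega>)"
      by (rule integral_lborel_pi_eq) (simp add: \<phi>_def F'0)
    also have "\<dots> = (LINT \<omega>|lborel. 1 / (2 * pi) * (F \<omega> * H (- \<omega>)))"
    proof (rule Bochner_Integration.integral_cong)
      fix \<omega>
      have "?e \<omega> t * ?e (- \<omega>) t = 1" by (simp flip: exp_add)
      then show "\<phi> \<omega> * \<psi> \<omega> = 1 / (2 * pi) * (F \<omega> * H (- \<omega>))"
        unfolding \<phi>_def \<psi>_def F'_def by (metis (no_types, opaque_lifting) mult.assoc mult.commute mult_1)
    qed simp
    finally show ?thesis by simp
  qed
  also have "(LINT \<omega>|lborel. F \<omega> * H (- \<omega>)) = (LINT x|lborel. f x * h x)"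
  \<comment> \<open>The forward transform of the reflected spectrum is the inverse integral of
    \<open>H\<close>, hence \<open>h\<close> itself.\<close>
  proof (rule has_L2_fourier_transform_duality[OF f(1) _ Hneg _ h(1), symmetric])
    show "integrable lborel (\<lambda>\<omega>. H (- \<omega>))"
      by (rule square_integrable_zero_outside_integrable[OF Hneg, of "-pi" pi]) (auto intro!: H(2))
    show "h x = (LINT \<omega>|lborel. H (- \<omega>) * exp (- \<i> * of_real \<omega> * of_real x))" for x
      unfolding h(2) by (subst lborel_integral_real_affine[of "-1" _ 0]) auto
  qed
  finally have val: "2 * pi * (LINT \<omega>|lborel_pi. \<phi> \<omega> * \<psi> \<omega>) = (LINT x|lborel. f x * h x)" .
  show ?thesis using PL_parseval[OF \<phi> \<psi>] unfolding summand val .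
qed

text \<open>A transform is determined only up to a null set, so it may be set to zero outside the
  band. The support condition then holds at every point, as the preceding lemmas require.\<close>

lemma BL_fourier_transform:
  assumes "f \<in> BL \<sigma>"
  obtains F where "has_L2_fourier_transform f F" "\<And>\<omega>. \<omega> \<notin> {-\<sigma>..\<sigma>} \<Longrightarrow> F \<omega> = 0"
proof -
  from assms obtain F where F: "has_L2_fourier_transform f F"
    and supp: "AE \<omega> in lborel. \<omega> \<notin> {-\<sigma>..\<sigma>} \<longrightarrow> F \<omega> = 0"
    by (auto simp: BL_def)
  define G where "G \<omega> = indicator {-\<sigma>..\<sigma>} \<omega> * F \<omega>" for \<omega>
  have AE: "AE \<omega> in lborel. F \<omega> = G \<omega>"
    using supp by eventually_elim (auto simp: G_def indicator_def)
  have "square_integrable G"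
    unfolding G_def using F
    by (intro square_integrable_mult_bounded[where B = 1]) (auto simp: has_L2_fourier_transform_def indicator_def)
  moreover have "(\<integral>\<^sup>+ \<omega>. ennreal ((norm (F \<omega> - A \<omega>))\<^sup>2) \<partial>lborel) = (\<integral>\<^sup>+ \<omega>. ennreal ((norm (G \<omega> - A \<omega>))\<^sup>2) \<partial>lborel)" for A
    by (rule nn_integral_cong_AE) (use AE in eventually_elim, simp)
  ultimately have "has_L2_fourier_transform f G"
    using F unfolding has_L2_fourier_transform_def by simp
  then show ?thesis by (rule that) (simp add: G_def)
qed

theorem proposition1p2:
  fixes f g :: "real \<Rightarrow> complex" and u :: real
  assumes "f \<in> BL pi" and "g \<in> BL pi"
  shows "(\<forall>t. (\<lambda>n. (chromatic_deriv n f t)\<^sup>2) sums (LINT x|lborel. (f x)\<^sup>2)) \<and>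
         (\<forall>t. (\<lambda>n. chromatic_deriv n f t * chromatic_deriv n g t)
                sums (LINT x|lborel. f x * g x)) \<and>
         (\<forall>t. (\<lambda>n. chromatic_deriv n f t * chromatic_deriv n (\<lambda>s. g (u - s)) t)
                sums (LINT x|lborel. f x * g (u - x)))"
proof -
  have spectrum: "\<exists>H. square_integrable H \<and> (\<forall>\<omega>. \<omega> \<notin> {-pi..pi} \<longrightarrow> H \<omega> = 0) \<and>
      (\<forall>x. h x = (LINT \<omega>|lborel. H \<omega> * exp (\<i> * of_real \<omega> * of_real x)))" if h: "h \<in> BL pi" for h
  proof -
    obtain F where F: "has_L2_fourier_transform h F" "\<And>\<omega>. \<omega> \<notin> {-pi..pi} \<Longrightarrow> F \<omega> = 0"
      using BL_fourier_transform[OF h] by blast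
    have Fsq: "square_integrable F" using F(1) by (simp add: has_L2_fourier_transform_def)
    have "h x = (LINT \<omega>|lborel. (1 / (2 * pi) * F \<omega>) * exp (\<i> * of_real \<omega> * of_real x))" for x
      using L2_fourier_inversion[OF F(1) _ square_integrable_zero_outside_integrable[OF Fsq F(2)], of x] h
      by (simp add: BL_def continuous_on_eq_continuous_at)
    moreover have "square_integrable (\<lambda>\<omega>. 1 / (2 * pi) * F \<omega>)"
      by (rule square_integrable_mult_bounded[OF Fsq _ order_refl]) simp
    ultimately show ?thesis using F(2) by (intro exI[of _ "\<lambda>\<omega>. 1 / (2 * pi) * F \<omega>"]) auto
  qed
  obtain F where F: "has_L2_fourier_transform f F" "\<And>\<omega>. \<omega> \<notin> {-pi..pi} \<Longrightarrow> F \<omega> = 0"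
    using BL_fourier_transform[OF assms(1)] by blast
  have cont: "continuous_on UNIV f" and fsq: "square_integrable f" and gsq: "square_integrable g"
    using assms by (auto simp: BL_def)
  note parseval = chromatic_parseval[OF F(1) cont F(2)]
  obtain G where G: "square_integrable G" "\<And>\<omega>. \<omega> \<notin> {-pi..pi} \<Longrightarrow> G \<omega> = 0"
    "\<And>x. g x = (LINT \<omega>|lborel. G \<omega> * exp (\<i> * of_real \<omega> * of_real x))"
    using spectrum[OF assms(2)] by blast
  have 1: "(\<lambda>n. chromatic_deriv n f t * chromatic_deriv n f t) sums (LINT x|lborel. f x * f x)" for t
    using spectrum[OF assms(1)] parseval fsq by blast
  have 2: "(\<lambda>n. chromatic_deriv n f t * chromatic_deriv n g t) sums (LINT x|lborel. f x * g x)" for t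
    by (rule parseval[OF _ G(1,2) gsq G(3)])
  have 3: "(\<lambda>n. chromatic_deriv n f t * chromatic_deriv n (\<lambda>s. g (u - s)) t) sums (LINT x|lborel. f x * g (u - x))" for t
  proof (rule parseval)
    \<comment> \<open>The spectrum of g(u - x): reflecting the frequency in the representation of
      \<open>g\<close> makes x occur with a positive sign and leaves the phase of the shift by
      \<open>u\<close>.\<close>
    let ?H = "\<lambda>\<omega>. exp (- \<i> * of_real \<omega> * of_real u) * G (- \<omega>)"
    have "square_integrable (\<lambda>\<omega>. G (- \<omega>))"
      using square_integrable_affine[OF G(1), of "-1" 0] by simp
    then show "square_integrable ?H"
      by (rule square_integrable_mult_bounded[where B = 1]) (auto simp: norm_exp_eq_Re)
    show "?H \<omega> = 0" if "\<omega> \<notin> {-pi..pi}" for \<omega>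
      using that G(2)[of "- \<omega>"] by auto
    show "square_integrable (\<lambda>s. g (u - s))"
      using square_integrable_affine[OF gsq, of "-1" u] by simp
    show "g (u - x) = (LINT \<omega>|lborel. ?H \<omega> * exp (\<i> * of_real \<omega> * of_real x))" for x
    proof -
      have "g (u - x) = (LINT \<omega>|lborel. G (- \<omega>) * exp (\<i> * of_real (- \<omega>) * of_real (u - x)))"
        unfolding G(3) by (subst lborel_integral_real_affine[of "-1" _ 0]) auto
      also have "\<dots> = (LINT \<omega>|lborel. ?H \<omega> * exp (\<i> * of_real \<omega> * of_real x))"
        by (rule Bochner_Integration.integral_cong) (simp_all add: algebra_simps flip: exp_add)
      finally show ?thesis .
    qed
  qed
  show ?thesis using 1 2 3 by (simp add: power2_eq_square)
qed

end
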